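(* Let the functions $L_1,\dots,L_n$ and $A_1,\dots,A_n$ of $(x^1,\dots,x^n,v^1,\dots,v^n)$ (components of extended covector fields $\mathbf L$ and $\mathbf A$, see context) satisfy the differential equations $$\frac{\partial L_s}{\partial v^r}-\frac{\partial L_r}{\partial v^s}=L_s\,A_r-L_r\,A_s,\qquad 1\le r,s\le n.$$ Define the symmetric matrix $$u_{sr}=\frac12\left(\frac{\partial L_s}{\partial v^r}+\frac{\partial L_r}{\partial v^s}\right)-\frac{L_s\,A_r+L_r\,A_s}{2}.$$ Suppose that the metric tensor $g_{qk}=\partial L_q/\partial v^k$ is non-degenerate, and that one of the following two conditions is fulfilled: (i) the matrix $(u_{sr})$ is degenerate; (ii) the matrix $(u_{sr})$ is non-degenerate and $\Vert\mathbf L\Vert_{\mathbf u}=\sum_{s=1}^n\sum_{r=1}^n w^{rs}\,L_r\,L_s\neq 0$, where $(w^{rs})$ is the inverse matrix of $(u_{rs})$. Then this solution defines a locally diffeomorphic generalized Legendre map $\lambda: TM\to T^*M$, given in local coordinates by $p_i=L_i(x^1,\dots,x^n,v^1,\dots,v^n)$, $i=1,\dots,n$.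
   Context: $M$ is a smooth manifold of dimension $n\ge 3$ with local coordinates $x^1,\dots,x^n$; $v^1,\dots,v^n$ are the components of a tangent vector $\mathbf v$ and $p_1,\dots,p_n$ the components of a covector $\mathbf p$. An extended covector field is a covector-valued function of a point $q=(p,\mathbf v)$ of the tangent bundle $TM$ with values in $T^*_p(M)$; its components are functions of $x^1,\dots,x^n,v^1,\dots,v^n$. A generalized Legendre map is a smooth fiber-preserving map from $TM$ to $T^*M$ (each fiber of $TM$ is mapped into the fiber of $T^*M$ over the same base point), given in a local chart by $p_i=L_i(x^1,\dots,x^n,v^1,\dots,v^n)$. The matrix $g_{qk}=\partial L_q/\partial v^k$ is in general non-symmetric; $g^{qk}$ denotes the entries of its inverse matrix. Put $L^i=\sum_{s=1}^n L_s\,g^{si}$ and $|\mathbf L|^2=\sum_{s=1}^n L_s\,L^s$ (a notation for this scalar, which need not be positive). It is assumed throughout that $|\mathbf L|^2\neq 0$. *)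

theory Defs
  imports "HOL-Analysis.Analysis"
begin

section \<open>Smooth maps between open subsets of normed spaces\<close>

text \<open>\<open>Ck k S f\<close> says that \<open>f\<close> is \<open>k\<close> times continuously differentiable on \<open>S\<close>. It is
  only used for open subsets \<open>S\<close> of Euclidean spaces, where continuity of the derivative can be
  tested on every direction \<open>h\<close> separately.\<close>

primrec Ck :: "nat \<Rightarrow> 'a::real_normed_vector set \<Rightarrow> ('a \<Rightarrow> 'b::real_normed_vector) \<Rightarrow> bool" where
  "Ck 0 = (\<lambda>S f. continuous_on S f)"
| "Ck (Suc k) = (\<lambda>S f. (\<forall>x\<in>S. f differentiable (at x)) \<and>
      (\<forall>h. Ck k S (\<lambda>x. frechet_derivative f (at x) h)))"

definition smooth_on :: "'a::real_normed_vector set \<Rightarrow> ('a \<Rightarrow> 'b::real_normed_vector) \<Rightarrow> bool" where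
  "smooth_on S f \<longleftrightarrow> (\<forall>k. Ck k S f)"


section \<open>Smooth manifolds\<close>

text \<open>A chart is a pair of its domain and its coordinate map; the values of the latter outside
  of the domain are irrelevant. A manifold is given by an atlas: the underlying set is the union
  of the chart domains, and the topology is the one which makes all charts homeomorphisms
  onto open sets.\<close>

type_synonym ('a, 'e) chart = "'a set \<times> ('a \<Rightarrow> 'e)"
type_synonym ('a, 'e) atlas = "('a, 'e) chart set"

definition inv_chart :: "('a, 'e) chart \<Rightarrow> 'e \<Rightarrow> 'a" where
  "inv_chart c = the_inv_into (fst c) (snd c)"

definition transition :: "('a, 'e) chart \<Rightarrow> ('a, 'f) chart \<Rightarrow> 'e \<Rightarrow> 'f" where
  "transition c d = snd d \<circ> inv_chart c"

definition carrier_of :: "('a, 'e) atlas \<Rightarrow> 'a set" where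
  "carrier_of \<A> = (\<Union>c\<in>\<A>. fst c)"

definition atlas_topology :: "('a, 'e::euclidean_space) atlas \<Rightarrow> 'a topology" where
  "atlas_topology \<A> =
     topology (\<lambda>W. W \<subseteq> carrier_of \<A> \<and> (\<forall>c\<in>\<A>. open (snd c ` (W \<inter> fst c))))"

definition smooth_atlas :: "('a, 'e::euclidean_space) atlas \<Rightarrow> bool" where
  "smooth_atlas \<A> \<longleftrightarrow>
     (\<forall>c\<in>\<A>. inj_on (snd c) (fst c)) \<and>
     (\<forall>c\<in>\<A>. \<forall>d\<in>\<A>. open (snd c ` (fst c \<inter> fst d)) \<and>
        smooth_on (snd c ` (fst c \<inter> fst d)) (transition c d))"

definition smooth_manifold :: "('a, 'e::euclidean_space) atlas \<Rightarrow> bool" where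
  "smooth_manifold \<A> \<longleftrightarrow> smooth_atlas \<A> \<and>
     Hausdorff_space (atlas_topology \<A>) \<and>
     second_countable (atlas_topology \<A>)"

definition smooth_map ::
  "('a, 'e::euclidean_space) atlas \<Rightarrow> ('b, 'f::euclidean_space) atlas \<Rightarrow> ('a \<Rightarrow> 'b) \<Rightarrow> bool" where
  "smooth_map \<A> \<B> f \<longleftrightarrow>
     continuous_map (atlas_topology \<A>) (atlas_topology \<B>) f \<and>
     (\<forall>c\<in>\<A>. \<forall>d\<in>\<B>.
        smooth_on (snd c ` (fst c \<inter> f -` fst d)) (snd d \<circ> f \<circ> inv_chart c))"

definition diffeomorphism ::
  "('a, 'e::euclidean_space) atlas \<Rightarrow> ('b, 'f::euclidean_space) atlas \<Rightarrow> ('a \<Rightarrow> 'b) \<Rightarrow> bool" where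
  "diffeomorphism \<A> \<B> f \<longleftrightarrow> smooth_map \<A> \<B> f \<and>
     bij_betw f (carrier_of \<A>) (carrier_of \<B>) \<and>
     smooth_map \<B> \<A> (the_inv_into (carrier_of \<A>) f)"

definition restrict_atlas :: "('a, 'e) atlas \<Rightarrow> 'a set \<Rightarrow> ('a, 'e) atlas" where
  "restrict_atlas \<A> W = (\<lambda>c. (fst c \<inter> W, snd c)) ` \<A>"

definition local_diffeomorphism ::
  "('a, 'e::euclidean_space) atlas \<Rightarrow> ('b, 'f::euclidean_space) atlas \<Rightarrow> ('a \<Rightarrow> 'b) \<Rightarrow> bool" where
  "local_diffeomorphism \<A> \<B> f \<longleftrightarrow>
     (\<forall>p\<in>carrier_of \<A>. \<exists>W. openin (atlas_topology \<A>) W \<and> p \<in> W \<and>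
        openin (atlas_topology \<B>) (f ` W) \<and>
        diffeomorphism (restrict_atlas \<A> W) (restrict_atlas \<B> (f ` W)) f)"


section \<open>Tangent and cotangent bundles\<close>

text \<open>Tangent vectors and covectors at \<open>p\<close> are given by their components in every chart around
  \<open>p\<close>, subject to the transformation laws \<open>v\<^sub>d = J v\<^sub>c\<close> and \<open>p\<^sub>c = J\<^sup>T p\<^sub>d\<close>, where
  \<open>J\<close> is the Jacobian matrix at \<open>p\<close> of the change of coordinates from \<open>c\<close> to \<open>d\<close>. For all other
  (irrelevant) arguments the value is fixed to be 0, so that equality of vectors is equality of
  functions.\<close>

type_synonym ('m, 'n) components = "('m, real^'n) chart \<Rightarrow> real^'n"
type_synonym ('m, 'n) bundle_point = "'m \<times> ('m, 'n) components"

definition jac :: "('m, real^'n) chart \<Rightarrow> ('m, real^'n) chart \<Rightarrow> 'm \<Rightarrow> real^'n^'n" where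
  "jac c d p = jacobian (transition c d) (at (snd c p))"

definition tangent_space :: "('m, real^'n) atlas \<Rightarrow> 'm \<Rightarrow> ('m, 'n) components set" where
  "tangent_space M p = {v.
     (\<forall>c\<in>M. \<forall>d\<in>M. p \<in> fst c \<inter> fst d \<longrightarrow> v d = jac c d p *v v c) \<and>
     (\<forall>c. \<not> (c \<in> M \<and> p \<in> fst c) \<longrightarrow> v c = 0)}"

definition cotangent_space :: "('m, real^'n) atlas \<Rightarrow> 'm \<Rightarrow> ('m, 'n) components set" where
  "cotangent_space M p = {\<omega>.
     (\<forall>c\<in>M. \<forall>d\<in>M. p \<in> fst c \<inter> fst d \<longrightarrow> \<omega> c = transpose (jac c d p) *v \<omega> d) \<and>
     (\<forall>c. \<not> (c \<in> M \<and> p \<in> fst c) \<longrightarrow> \<omega> c = 0)}"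

definition tangent_chart ::
  "('m, real^'n) atlas \<Rightarrow> ('m, real^'n) chart \<Rightarrow> (('m, 'n) bundle_point, (real^'n) \<times> (real^'n)) chart" where
  "tangent_chart M c =
     ({(p, v). p \<in> fst c \<and> v \<in> tangent_space M p}, \<lambda>(p, v). (snd c p, v c))"

definition cotangent_chart ::
  "('m, real^'n) atlas \<Rightarrow> ('m, real^'n) chart \<Rightarrow> (('m, 'n) bundle_point, (real^'n) \<times> (real^'n)) chart" where
  "cotangent_chart M c =
     ({(p, \<omega>). p \<in> fst c \<and> \<omega> \<in> cotangent_space M p}, \<lambda>(p, \<omega>). (snd c p, \<omega> c))"

definition tangent_bundle ::
  "('m, real^'n) atlas \<Rightarrow> (('m, 'n) bundle_point, (real^'n) \<times> (real^'n)) atlas" where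
  "tangent_bundle M = tangent_chart M ` M"

definition cotangent_bundle ::
  "('m, real^'n) atlas \<Rightarrow> (('m, 'n) bundle_point, (real^'n) \<times> (real^'n)) atlas" where
  "cotangent_bundle M = cotangent_chart M ` M"


section \<open>Extended covector fields and generalized Legendre maps\<close>

definition extended_covector_field ::
  "('m, real^'n) atlas \<Rightarrow> (('m, 'n) bundle_point \<Rightarrow> ('m, 'n) components) \<Rightarrow> bool" where
  "extended_covector_field M F \<longleftrightarrow>
     (\<forall>q\<in>carrier_of (tangent_bundle M). F q \<in> cotangent_space M (fst q))"

text \<open>The components \<open>(F\<^sub>1, \<dots>, F\<^sub>n)\<close> in the chart \<open>c\<close> as functions of
  \<open>(x\<^sup>1, \<dots>, x\<^sup>n, v\<^sup>1, \<dots>, v\<^sup>n)\<close>:\<close>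

definition field_components ::
  "('m, real^'n) atlas \<Rightarrow> (('m, 'n) bundle_point \<Rightarrow> ('m, 'n) components) \<Rightarrow>
     ('m, real^'n) chart \<Rightarrow> (real^'n) \<times> (real^'n) \<Rightarrow> real^'n" where
  "field_components M F c z = F (inv_chart (tangent_chart M c) z) c"

definition smooth_field ::
  "('m, real^'n) atlas \<Rightarrow> (('m, 'n) bundle_point \<Rightarrow> ('m, 'n) components) \<Rightarrow> bool" where
  "smooth_field M F \<longleftrightarrow>
     (\<forall>c\<in>M. smooth_on ((snd c ` fst c) \<times> UNIV) (field_components M F c))"

definition generalized_Legendre_map ::
  "('m, real^'n) atlas \<Rightarrow> (('m, 'n) bundle_point \<Rightarrow> ('m, 'n) bundle_point) \<Rightarrow> bool" where
  "generalized_Legendre_map M f \<longleftrightarrow>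
     smooth_map (tangent_bundle M) (cotangent_bundle M) f \<and>
     (\<forall>q\<in>carrier_of (tangent_bundle M). fst (f q) = fst q)"

definition map_of_field ::
  "(('m, 'n) bundle_point \<Rightarrow> ('m, 'n) components) \<Rightarrow> ('m, 'n) bundle_point \<Rightarrow> ('m, 'n) bundle_point" where
  "map_of_field F = (\<lambda>q. (fst q, F q))"


section \<open>Coordinate expressions\<close>

text \<open>In this section \<open>F\<close>, \<open>L\<close> and \<open>A\<close> stand for component functions of \<open>(x, v)\<close> in a chart.
  \<open>dv F s r (x, v)\<close> is the partial derivative of \<open>F\<^sub>s\<close> with respect to \<open>v\<^sup>r\<close>.\<close>

definition dv :: "((real^'n) \<times> (real^'n) \<Rightarrow> real^'n) \<Rightarrow> 'n \<Rightarrow> 'n \<Rightarrow> (real^'n) \<times> (real^'n) \<Rightarrow> real" where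
  "dv F s r = (\<lambda>(x, v). deriv (\<lambda>t. F (x, v + t *\<^sub>R axis r 1) $ s) 0)"

definition g_matrix :: "((real^'n) \<times> (real^'n) \<Rightarrow> real^'n) \<Rightarrow> (real^'n) \<times> (real^'n) \<Rightarrow> real^'n^'n" where
  "g_matrix L z = (\<chi> q k. dv L q k z)"

definition raised :: "((real^'n) \<times> (real^'n) \<Rightarrow> real^'n) \<Rightarrow> (real^'n) \<times> (real^'n) \<Rightarrow> real^'n" where
  "raised L z = (\<chi> i. \<Sum>s\<in>UNIV. L z $ s * matrix_inv (g_matrix L z) $ s $ i)"

definition square_norm :: "((real^'n) \<times> (real^'n) \<Rightarrow> real^'n) \<Rightarrow> (real^'n) \<times> (real^'n) \<Rightarrow> real" where
  "square_norm L z = (\<Sum>s\<in>UNIV. L z $ s * raised L z $ s)"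

definition u_matrix ::
  "((real^'n) \<times> (real^'n) \<Rightarrow> real^'n) \<Rightarrow> ((real^'n) \<times> (real^'n) \<Rightarrow> real^'n) \<Rightarrow>
     (real^'n) \<times> (real^'n) \<Rightarrow> real^'n^'n" where
  "u_matrix L A z = (\<chi> s r. (1/2) * (dv L s r z + dv L r s z)
     - (L z $ s * A z $ r + L z $ r * A z $ s) / 2)"

definition u_norm ::
  "((real^'n) \<times> (real^'n) \<Rightarrow> real^'n) \<Rightarrow> ((real^'n) \<times> (real^'n) \<Rightarrow> real^'n) \<Rightarrow>
     (real^'n) \<times> (real^'n) \<Rightarrow> real" where
  "u_norm L A z = (\<Sum>s\<in>UNIV. \<Sum>r\<in>UNIV.
     matrix_inv (u_matrix L A z) $ r $ s * L z $ r * L z $ s)"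

end

theory Submission
  imports Defs
begin

text \<open>
  In the charts of the two bundles over a chart of \<open>M\<close> the map reads \<open>(x, v) \<mapsto> (x, L(x, v))\<close>. Its
  derivative is block triangular with diagonal blocks \<open>1\<close> and \<open>g\<close>, hence invertible, and the inverse
  function theorem provides local inverses. The derivative of such an inverse \<open>\<psi>\<close> at \<open>y\<close> is
  \<open>(a, b) \<mapsto> (a, g\<^sup>-\<^sup>1 (b - D L (a, 0)))\<close> taken at \<open>\<psi> y\<close>. By Cramer's rule it is \<open>C\<^sup>k\<close> in \<open>y\<close>
  whenever \<open>\<psi>\<close> is \<open>C\<^sup>k\<close>, so \<open>\<psi>\<close> is smooth.
\<close>

section \<open>Calculus of \<open>C\<^sup>k\<close> maps\<close>

text \<open>The inverse function theorem works in one pair of charts, while smoothness on manifolds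
  quantifies over all pairs of charts, here also those of restricted atlases. Two gluing lemmas
  bridge this gap: near each point one suitable pair suffices, because any other representative
  arises from it by composing with transition maps on both sides. They require smooth bundle
  atlases, and there the cocycle identity of the Jacobians enters: it shows that vectors with
  prescribed components exist, so that bundle charts have full products as images. The form of the
  calculus rules comes from \<open>Ck\<close>, which tests derivatives along fixed directions. Where
  a direction varies with the point, as in the chain rule or in the change of tangent coordinates,
  it is expanded over a basis.\<close>

lemma Ck_cong:
  assumes "open S" "\<And>x. x \<in> S \<Longrightarrow> f x = g x" "Ck k S f"
  shows "Ck k S g"
  using assms(2,3)
proof (induction k arbitrary: f g)
  case 0
  then show ?case by (simp add: continuous_on_eq)
next
  case (Suc k)
  \<comment> \<open>Openness of \<open>S\<close> makes the derivative at \<open>x\<close> depend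
    only on values inside \<open>S\<close>. The directional derivatives therefore agree on
    \<open>S\<close>, and the induction hypothesis applies to them.\<close>
  have D: "(g has_derivative frechet_derivative f (at x)) (at x)" if "x \<in> S" for x
  proof (rule has_derivative_transform_within_open[OF _ \<open>open S\<close> that])
    show "(f has_derivative frechet_derivative f (at x)) (at x)"
      using Suc.prems(2) that by (simp add: frechet_derivative_works)
  qed (rule Suc.prems(1))
  have E: "frechet_derivative g (at x) h = frechet_derivative f (at x) h" if "x \<in> S" for x h
    using frechet_derivative_at[OF D[OF that]] by simp
  have "Ck k S (\<lambda>x. frechet_derivative g (at x) h)" for h
    by (rule Suc.IH[of "\<lambda>x. frechet_derivative f (at x) h"]) (use Suc.prems E in auto)
  then show ?case using D by (auto simp: differentiable_def)
qed

text \<open>\<open>frechet_derivative\<close> is a choice operator and opaque to calculation;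
  uniqueness of derivatives allows any explicit formula \<open>f'\<close> in its place. The calculus
  rules below make their successor step this way.\<close>

lemma Ck_SucI:
  assumes "open S" "\<And>x. x \<in> S \<Longrightarrow> (f has_derivative f' x) (at x)"
    and "\<And>h. Ck k S (\<lambda>x. f' x h)"
  shows "Ck (Suc k) S f"
proof -
  have "Ck k S (\<lambda>x. frechet_derivative f (at x) h)" for h
    by (rule Ck_cong[OF \<open>open S\<close> _ assms(3)[of h]])
       (use frechet_derivative_at[OF assms(2)] in metis)
  then show ?thesis using assms(2) by (auto simp: differentiable_def)
qed

lemma Ck_SucD:
  assumes "Ck (Suc k) S f"
  shows "x \<in> S \<Longrightarrow> (f has_derivative frechet_derivative f (at x)) (at x)"
    and "Ck k S (\<lambda>x. frechet_derivative f (at x) h)"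
  using assms by (auto simp: frechet_derivative_works)

lemma Ck_subset: "Ck k S f \<Longrightarrow> T \<subseteq> S \<Longrightarrow> Ck k T f"
  by (induction k arbitrary: f) (auto intro: continuous_on_subset)

text \<open>Each layer of \<open>Ck\<close> is a condition at the points of the set and uses
  derivatives in the full space, not within the set. Hence the neighbourhoods \<open>T\<close> may
  stick out of \<open>S\<close>.\<close>

lemma Ck_local:
  assumes "\<And>x. x \<in> S \<Longrightarrow> \<exists>T. open T \<and> x \<in> T \<and> Ck k T f"
  shows "Ck k S f"
  using assms
proof (induction k arbitrary: f)
  case 0
  show ?case
    unfolding Ck.simps
  proof (rule continuous_at_imp_continuous_on, rule ballI)
    fix x assume "x \<in> S"
    with 0 obtain T where "open T" "x \<in> T" "continuous_on T f" by auto
    then show "isCont f x" using continuous_on_eq_continuous_at by blast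
  qed
next
  case (Suc k)
  have "\<exists>T. open T \<and> x \<in> T \<and> f differentiable at x \<and> Ck k T (\<lambda>x. frechet_derivative f (at x) h)"
    if "x \<in> S" for x h
    using Suc.prems[OF that] by auto
  then show ?case by (auto intro!: Suc.IH)
qed

lemma Ck_Suc_imp_Ck: "Ck (Suc k) S f \<Longrightarrow> Ck k S f"
proof (induction k arbitrary: f)
  case 0
  then show ?case
    by (auto intro!: continuous_at_imp_continuous_on differentiable_imp_continuous_within)
next
  case (Suc k)
  then show ?case by (metis Ck.simps(2))
qed

lemma Ck_const: "Ck k S (\<lambda>x. c)"
  by (induction k arbitrary: c) auto

lemma Ck_bounded_linear_compose:
  assumes "bounded_linear l" "open S" "Ck k S f"
  shows "Ck k S (\<lambda>x. l (f x))"
  using assms(3)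
proof (induction k arbitrary: f)
  case 0
  then show ?case using assms(1)
    by (simp add: linear_continuous_on bounded_linear.continuous_on)
next
  case (Suc k)
  show ?case
  proof (rule Ck_SucI[where f' = "\<lambda>x h. l (frechet_derivative f (at x) h)"])
    show "((\<lambda>x. l (f x)) has_derivative (\<lambda>h. l (frechet_derivative f (at x) h))) (at x)"
      if "x \<in> S" for x
      by (intro bounded_linear.has_derivative[OF assms(1)] Ck_SucD(1)[OF Suc.prems] that)
  qed (intro \<open>open S\<close> Suc.IH Ck_SucD(2)[OF Suc.prems])+
qed

lemma Ck_bounded_linear:
  assumes "bounded_linear l" "open S"
  shows "Ck k S l"
proof (cases k)
  case 0
  then show ?thesis using assms by (simp add: linear_continuous_on)
next
  case (Suc j)
  then show ?thesis
    unfolding Suc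
    by (intro Ck_SucI[where f' = "\<lambda>x. l"] Ck_const bounded_linear_imp_has_derivative assms)
qed

lemma Ck_add:
  assumes "open S" "Ck k S f" "Ck k S g"
  shows "Ck k S (\<lambda>x. f x + g x)"
  using assms(2,3)
proof (induction k arbitrary: f g)
  case 0
  then show ?case by (auto intro: continuous_intros)
next
  case (Suc k)
  show ?case
  proof (rule Ck_SucI[where f' = "\<lambda>x h. frechet_derivative f (at x) h + frechet_derivative g (at x) h"])
    show "((\<lambda>x. f x + g x) has_derivative
        (\<lambda>h. frechet_derivative f (at x) h + frechet_derivative g (at x) h)) (at x)"
      if "x \<in> S" for x
      by (intro has_derivative_add Suc.prems[THEN Ck_SucD(1)] that)
  qed (intro \<open>open S\<close> Suc.IH Suc.prems[THEN Ck_SucD(2)])+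
qed

lemma Ck_sum:
  assumes "open S" "\<And>i. i \<in> I \<Longrightarrow> Ck k S (f i)"
  shows "Ck k S (\<lambda>x. \<Sum>i\<in>I. f i x)"
  using assms(2) by (induction I rule: infinite_finite_induct) (simp_all add: Ck_const Ck_add[OF \<open>open S\<close>])

text \<open>The product rule gives two terms of the same shape with one factor differentiated, so
  the induction generalises over both factors; the undifferentiated factor drops one order by
  \<open>Ck_Suc_imp_Ck\<close>.\<close>

lemma Ck_bilinear:
  assumes "bounded_bilinear b" "open S" "Ck k S f" "Ck k S g"
  shows "Ck k S (\<lambda>x. b (f x) (g x))"
  using assms(3,4)
proof (induction k arbitrary: f g)
  case 0
  then show ?case by (auto intro: bounded_bilinear.continuous_on[OF assms(1)])
next
  case (Suc k)
  show ?case
  proof (rule Ck_SucI[where f' = "\<lambda>x h. b (f x) (frechet_derivative g (at x) h) + b (frechet_derivative f (at x) h) (g x)"])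
    show "Ck k S (\<lambda>x. b (f x) (frechet_derivative g (at x) h) + b (frechet_derivative f (at x) h) (g x))" for h
      by (intro Ck_add Suc.IH \<open>open S\<close> Suc.prems[THEN Ck_SucD(2)] Suc.prems[THEN Ck_Suc_imp_Ck])
    show "((\<lambda>x. b (f x) (g x)) has_derivative
        (\<lambda>h. b (f x) (frechet_derivative g (at x) h) + b (frechet_derivative f (at x) h) (g x))) (at x)"
      if "x \<in> S" for x
      by (intro bounded_bilinear.FDERIV[OF assms(1)] Suc.prems[THEN Ck_SucD(1)] that)
  qed (rule \<open>open S\<close>)
qed

lemmas Ck_scaleR = Ck_bilinear[OF bounded_bilinear_scaleR]
lemmas Ck_mult = Ck_bilinear[OF bounded_bilinear_mult]
lemmas Ck_inner = Ck_bilinear[OF bounded_bilinear_inner]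

lemma Ck_diff:
  assumes "open S" "Ck k S f" "Ck k S g"
  shows "Ck k S (\<lambda>x. f x - g x)"
  using Ck_add[OF assms(1,2) Ck_bounded_linear_compose[OF bounded_linear_minus[OF bounded_linear_ident] assms(1,3)]]
  by simp

lemma linear_Basis_expansion:
  fixes D :: "'a::euclidean_space \<Rightarrow> 'b::real_vector"
  assumes "linear D"
  shows "D v = (\<Sum>b\<in>Basis. (v \<bullet> b) *\<^sub>R D b)"
proof -
  have "D (\<Sum>b\<in>Basis. (v \<bullet> b) *\<^sub>R b) = (\<Sum>b\<in>Basis. (v \<bullet> b) *\<^sub>R D b)"
    by (simp add: linear_sum[OF assms] linear_scale[OF assms] del: euclidean_representation)
  then show ?thesis unfolding euclidean_representation .
qed

text \<open>The chain rule evaluates the derivative of \<open>g\<close> in the direction Df(x)h,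
  which moves with \<open>x\<close>, while \<open>Ck\<close> controls fixed directions. Expansion
  over \<open>Basis\<close> leaves derivatives of \<open>g\<close> in fixed directions composed with
  the same \<open>f\<close>, which the induction hypothesis covers.\<close>

lemma Ck_compose:
  fixes g :: "'b::euclidean_space \<Rightarrow> 'c::real_normed_vector"
  assumes "open S" "open T" "f ` S \<subseteq> T" "Ck k S f" "Ck k T g"
  shows "Ck k S (\<lambda>x. g (f x))"
  using assms(4,5)
proof (induction k arbitrary: g)
  case 0
  then show ?case using assms(3) by (auto intro: continuous_on_compose2)
next
  case (Suc k)
  show ?case
  proof (rule Ck_SucI[where f' = "\<lambda>x h. \<Sum>b\<in>Basis. (frechet_derivative f (at x) h \<bullet> b) *\<^sub>R frechet_derivative g (at (f x)) b"])
    fix x assume "x \<in> S"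
    then have "f x \<in> T" using assms(3) by blast
    have f: "(f has_derivative frechet_derivative f (at x)) (at x)"
      and g: "(g has_derivative frechet_derivative g (at (f x))) (at (f x))"
      by (intro Suc.prems[THEN Ck_SucD(1)] \<open>x \<in> S\<close> \<open>f x \<in> T\<close>)+
    note E = linear_Basis_expansion[OF has_derivative_linear[OF g]]
    show "((\<lambda>x. g (f x)) has_derivative
        (\<lambda>h. \<Sum>b\<in>Basis. (frechet_derivative f (at x) h \<bullet> b) *\<^sub>R frechet_derivative g (at (f x)) b)) (at x)"
      using has_derivative_compose[OF f g] by (subst (asm) E)
  next
    show "Ck k S (\<lambda>x. \<Sum>b\<in>Basis. (frechet_derivative f (at x) h \<bullet> b) *\<^sub>R frechet_derivative g (at (f x)) b)" for h
      by (intro Ck_sum Ck_scaleR Ck_inner Ck_const \<open>open S\<close> Suc.IH Suc.prems[THEN Ck_SucD(2)]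
          Ck_Suc_imp_Ck[OF Suc.prems(1)])
  qed (rule \<open>open S\<close>)
qed

lemma Ck_Pair:
  assumes "open S" "Ck k S f" "Ck k S g"
  shows "Ck k S (\<lambda>x. (f x, g x))"
proof -
  have "bounded_linear (\<lambda>a. (a, 0))" "bounded_linear (\<lambda>b. (0, b))"
    by (intro bounded_linear_intros)+
  then show ?thesis
    using Ck_add[OF assms(1)
        Ck_bounded_linear_compose[OF _ assms(1,2), of "\<lambda>a. (a, 0)"]
        Ck_bounded_linear_compose[OF _ assms(1,3), of "\<lambda>b. (0, b)"]]
    by simp
qed

lemma Ck_vec_nth:
  fixes f :: "'a::real_normed_vector \<Rightarrow> 'b::real_normed_vector^'n"
  assumes "open S" "Ck k S f"
  shows "Ck k S (\<lambda>x. f x $ i)"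
  by (intro Ck_bounded_linear_compose[OF bounded_linear_vec_nth] assms)

lemma Ck_vec_lambda:
  fixes f :: "'a::real_normed_vector \<Rightarrow> real^'n"
  assumes "open S" "\<And>i. Ck k S (\<lambda>x. f x $ i)"
  shows "Ck k S f"
proof -
  have eq: "f = (\<lambda>x. \<Sum>i\<in>UNIV. (f x $ i) *\<^sub>R axis i 1)"
    by (simp add: vec_eq_iff fun_eq_iff axis_def if_distrib cong: if_cong)
  show ?thesis
    by (subst eq) (intro Ck_sum Ck_scaleR Ck_const assms)
qed

section \<open>Determinants and solutions of linear systems depending on a parameter\<close>

lemma Ck_prod:
  fixes f :: "'i \<Rightarrow> 'a::real_normed_vector \<Rightarrow> real"
  assumes "open S" "\<And>i. i \<in> I \<Longrightarrow> Ck k S (f i)"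
  shows "Ck k S (\<lambda>x. \<Prod>i\<in>I. f i x)"
  using assms(2) by (induction I rule: infinite_finite_induct) (simp_all add: Ck_const Ck_mult[OF \<open>open S\<close>])

text \<open>The derivative of the reciprocal contains only the reciprocal itself and the derivative
  of \<open>f\<close>, so order \<open>k\<close> of the reciprocal yields order
  \<open>Suc k\<close>.\<close>

lemma Ck_inverse:
  fixes f :: "'a::real_normed_vector \<Rightarrow> real"
  assumes "open S" "Ck k S f" "\<And>x. x \<in> S \<Longrightarrow> f x \<noteq> 0"
  shows "Ck k S (\<lambda>x. inverse (f x))"
  using assms(2)
proof (induction k)
  case 0
  then show ?case using assms(3) by (auto intro: continuous_intros)
next
  case (Suc k)
  show ?case
  \<comment> \<open>The sign is written as a subtraction from 0 so that \<open>Ck_diff\<close> and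
    \<open>Ck_const\<close> match.\<close>
  proof (rule Ck_SucI[where f' = "\<lambda>x h. 0 - inverse (f x) * frechet_derivative f (at x) h * inverse (f x)"])
    show "Ck k S (\<lambda>x. 0 - inverse (f x) * frechet_derivative f (at x) h * inverse (f x))" for h
      by (intro Ck_diff Ck_const Ck_mult \<open>open S\<close> Suc.IH Ck_SucD(2)[OF Suc.prems] Ck_Suc_imp_Ck[OF Suc.prems])
    show "((\<lambda>x. inverse (f x)) has_derivative
        (\<lambda>h. 0 - inverse (f x) * frechet_derivative f (at x) h * inverse (f x))) (at x)" if "x \<in> S" for x
      using Deriv.has_derivative_inverse[OF assms(3)[OF that] Ck_SucD(1)[OF Suc.prems that]] by simp
  qed (rule \<open>open S\<close>)
qed

lemma Ck_det:
  fixes B :: "'a::real_normed_vector \<Rightarrow> real^'n^'n"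
  assumes "open S" "\<And>i j. Ck k S (\<lambda>x. B x $ i $ j)"
  shows "Ck k S (\<lambda>x. det (B x))"
  unfolding det_def by (intro Ck_sum Ck_mult Ck_prod Ck_const assms)

lemma matrix_mul_matrix_inv: "invertible B \<Longrightarrow> B ** matrix_inv B = mat 1"
  unfolding invertible_def matrix_inv_def by (rule conjunct1[OF someI_ex])

lemma matrix_inv_matrix_mul: "invertible B \<Longrightarrow> matrix_inv B ** B = mat 1"
  unfolding invertible_def matrix_inv_def by (rule conjunct2[OF someI_ex])

text \<open>Each component is a polynomial in the entries of \<open>B\<close> and \<open>w\<close>
  times one reciprocal of a determinant. The inverse appears only as applied to a vector, the form
  in which it occurs in the derivative of a local inverse.\<close>

lemma Ck_matrix_inv_mult:
  fixes B :: "'a::real_normed_vector \<Rightarrow> real^'n^'n"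
  assumes "open S" "\<And>i j. Ck k S (\<lambda>x. B x $ i $ j)" "Ck k S w"
    and det: "\<And>x. x \<in> S \<Longrightarrow> det (B x) \<noteq> 0"
  shows "Ck k S (\<lambda>x. matrix_inv (B x) *v w x)"
proof -
  \<comment> \<open>The numerator matrix of Cramer's rule for component \<open>l\<close>.\<close>
  define C where "C l x = (\<chi> i j. if j = l then w x $ i else B x $ i $ j)" for l x
  have eq: "(\<chi> l. det (C l x) * inverse (det (B x))) = matrix_inv (B x) *v w x" if "x \<in> S" for x
  proof -
    have "B x *v (matrix_inv (B x) *v w x) = w x"
      using det[OF that]
      by (simp add: matrix_vector_mul_assoc matrix_mul_matrix_inv invertible_det_nz)
    then show ?thesis
      by (simp only: cramer[OF det[OF that]] C_def divide_inverse)
  qed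
  have "Ck k S (\<lambda>x. C l x $ i $ j)" for l i j
    using assms(2) Ck_vec_nth[OF assms(1,3)] by (cases "j = l") (simp_all add: C_def)
  then have "Ck k S (\<lambda>x. \<chi> l. det (C l x) * inverse (det (B x)))"
    by (intro Ck_vec_lambda \<open>open S\<close>, simp)
       (intro Ck_mult Ck_inverse Ck_det assms)
  with eq show ?thesis by (rule Ck_cong[OF \<open>open S\<close>])
qed

section \<open>Transfer from all finite orders to smooth maps\<close>

lemma smooth_on_Ck: "smooth_on S f \<Longrightarrow> Ck k S f"
  by (simp add: smooth_on_def)

lemma smooth_on_frechet_derivative:
  assumes "smooth_on S f"
  shows "smooth_on S (\<lambda>x. frechet_derivative f (at x) h)"
  using assms Ck_SucD(2) unfolding smooth_on_def by blast

lemma smooth_on_has_derivative: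
  assumes "smooth_on S f" "x \<in> S"
  shows "(f has_derivative frechet_derivative f (at x)) (at x)"
  by (rule Ck_SucD(1)[OF smooth_on_Ck[OF assms(1)] assms(2)])

lemma smooth_on_continuous_on: "smooth_on S f \<Longrightarrow> continuous_on S f"
  using smooth_on_Ck[of S f 0] by simp

lemma smooth_on_cong: "open S \<Longrightarrow> (\<And>x. x \<in> S \<Longrightarrow> f x = g x) \<Longrightarrow> smooth_on S f \<Longrightarrow> smooth_on S g"
  unfolding smooth_on_def using Ck_cong by blast

lemma smooth_on_subset: "smooth_on S f \<Longrightarrow> T \<subseteq> S \<Longrightarrow> smooth_on T f"
  unfolding smooth_on_def using Ck_subset by blast

lemma smooth_on_local:
  "(\<And>x. x \<in> S \<Longrightarrow> \<exists>T. open T \<and> x \<in> T \<and> smooth_on T f) \<Longrightarrow> smooth_on S f"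
  unfolding smooth_on_def by (intro allI Ck_local) blast

lemma smooth_on_compose:
  fixes g :: "'b::euclidean_space \<Rightarrow> 'c::real_normed_vector"
  assumes "open S" "open T" "f ` S \<subseteq> T" "smooth_on S f" "smooth_on T g"
  shows "smooth_on S (\<lambda>x. g (f x))"
  using assms Ck_compose[OF assms(1-3)] unfolding smooth_on_def by blast

lemma smooth_on_Pair:
  "open S \<Longrightarrow> smooth_on S f \<Longrightarrow> smooth_on S g \<Longrightarrow> smooth_on S (\<lambda>x. (f x, g x))"
  unfolding smooth_on_def using Ck_Pair by blast

text \<open>For functions of the base coordinates on a product with a full fibre, the shape of the
  images of bundle charts.\<close>

lemma smooth_on_fst_compose:
  fixes f :: "'a::euclidean_space \<Rightarrow> 'c::real_normed_vector"
  assumes "open S" "smooth_on S f"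
  shows "smooth_on (S \<times> (UNIV :: 'b::real_normed_vector set)) (\<lambda>z. f (fst z))"
proof -
  have "open (S \<times> (UNIV :: 'b::real_normed_vector set))" using assms(1) by (simp add: open_Times)
  moreover from this have "smooth_on (S \<times> (UNIV :: 'b set)) fst"
    unfolding smooth_on_def by (blast intro: Ck_bounded_linear bounded_linear_fst)
  ultimately show ?thesis by (intro smooth_on_compose[OF _ assms(1) _ _ assms(2)]) auto
qed

section \<open>Inverse functions\<close>

text \<open>The determinant condition is imposed on all of \<open>S\<close>, so that the explicit
  inverse of the derivative is available at every \<open>g y\<close>. The order of smoothness then
  grows on one fixed \<open>V\<close>, which does not shrink with \<open>k\<close>.\<close>

lemma fibred_inverse_function_theorem:
  fixes F :: "'a::euclidean_space \<times> (real^'n) \<Rightarrow> real^'n"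
  assumes "open S" "z0 \<in> S" and F: "smooth_on S F"
    and det: "\<And>z. z \<in> S \<Longrightarrow> det (matrix (\<lambda>k. frechet_derivative F (at z) (0, k))) \<noteq> 0"
  obtains U V g where "open U" "U \<subseteq> S" "z0 \<in> U" "open V"
    "homeomorphism U V (\<lambda>z. (fst z, F z)) g" "smooth_on V g"
proof -
  define \<phi> where "\<phi> = (\<lambda>z. (fst z, F z))"
  define D where "D z = frechet_derivative F (at z)" for z
  define G where "G z = matrix (\<lambda>k. D z (0, k))" for z
  \<comment> \<open>Solves the block triangular system by substitution: the base part is copied,
    then the fibre block is solved against what remains of the second component.\<close>
  define I where "I z = (\<lambda>w. (fst w, matrix_inv (G z) *v (snd w - D z (fst w, 0))))" for z
  define \<phi>' where "\<phi>' z = (\<lambda>w. (fst w, D z w))" for z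
  have D: "(F has_derivative D z) (at z)" if "z \<in> S" for z
    unfolding D_def by (rule smooth_on_has_derivative[OF F that])
  have D\<phi>: "(\<phi> has_derivative \<phi>' z) (at z)" if "z \<in> S" for z
    unfolding \<phi>_def \<phi>'_def
    by (intro has_derivative_Pair D that bounded_linear_imp_has_derivative bounded_linear_fst)
  have bl: "bounded_linear (\<phi>' z)" if "z \<in> S" for z
    using D\<phi>[OF that] by (rule has_derivative_bounded_linear)
  have split: "D z w = D z (fst w, 0) + G z *v snd w" if "z \<in> S" for z w
  proof -
    note lin = has_derivative_linear[OF D[OF that]]
    have "linear (\<lambda>k. D z (0, k))"
      by (intro linear_compose[OF _ lin, unfolded o_def] bounded_linear.linear bounded_linear_intros)
    from fun_cong[OF matrix_vector_mul(2)[OF this]] have "G z *v snd w = D z (0, snd w)"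
      unfolding G_def .
    then show ?thesis using linear_add[OF lin, of "(fst w, 0)" "(0, snd w)"] by simp
  qed
  have inv: "invertible (G z)" if "z \<in> S" for z
    using det[OF that] by (simp add: G_def D_def invertible_det_nz)
  have \<phi>'_I: "\<phi>' z \<circ> I z = id" if "z \<in> S" for z
  proof
    fix w
    have "D z (I z w) = snd w"
      unfolding split[OF that, of "I z w"]
      by (simp add: I_def matrix_vector_mul_assoc matrix_mul_matrix_inv[OF inv[OF that]])
    then show "(\<phi>' z \<circ> I z) w = id w"
      by (simp add: \<phi>'_def) (simp add: I_def)
  qed
  have I_\<phi>': "I z \<circ> \<phi>' z = id" if "z \<in> S" for z
  proof
    fix w
    have "matrix_inv (G z) *v (D z w - D z (fst w, 0)) = snd w"
      unfolding split[OF that, of w]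
      by (simp add: matrix_vector_mul_assoc matrix_inv_matrix_mul[OF inv[OF that]])
    then show "(I z \<circ> \<phi>' z) w = id w"
      by (simp add: \<phi>'_def I_def)
  qed
  have inv_\<phi>': "inv (\<phi>' z) = I z" if "z \<in> S" for z
    by (rule inv_unique_comp[OF \<phi>'_I[OF that] I_\<phi>'[OF that]])
  \<comment> \<open>Injectivity of \<open>\<phi>' z\<close> provides a linear left inverse
    \<open>J\<close>, and composing with \<open>I z\<close> on the right shows that \<open>J\<close>
    is \<open>I z\<close>. Finite dimension turns linearity into boundedness.\<close>
  have blI: "bounded_linear (I z)" if "z \<in> S" for z
  proof -
    have "inj (\<phi>' z)"
      using I_\<phi>'[OF that] inj_on_id[of UNIV] by (metis inj_on_imageI2)
    from linear_injective_left_inverse[OF bounded_linear.linear[OF bl] this] that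
    obtain J where "linear J" "J \<circ> \<phi>' z = id" by blast
    moreover from this have "J = I z"
      using \<phi>'_I[OF that] by (metis comp_assoc comp_id id_comp)
    ultimately have "linear (I z)" by simp
    then show ?thesis by (simp add: linear_conv_bounded_linear)
  qed
  have Blin: "blinfun_apply (Blinfun (\<phi>' z)) = \<phi>' z" if "z \<in> S" for z
    by (rule bounded_linear_Blinfun_apply[OF bl[OF that]])
  \<comment> \<open>The theorem takes derivatives as elements of the type of bounded operators,
    hence the wrapping by \<open>Blinfun\<close>; continuity into that type is checked on basis
    vectors.\<close>
  obtain U V g g' where U: "open U" "U \<subseteq> S" "z0 \<in> U" "open V"
    and hom: "homeomorphism U V \<phi> g"
    and g': "\<And>y. y \<in> V \<Longrightarrow> (g has_derivative g' y) (at y)"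
    and g'_eq: "\<And>y. y \<in> V \<Longrightarrow> g' y = inv (blinfun_apply (Blinfun (\<phi>' (g y))))"
  proof (rule inverse_function_theorem[of S \<phi> "\<lambda>z. Blinfun (\<phi>' z)" z0 "Blinfun (I z0)"])
    show "(\<phi> has_derivative blinfun_apply (Blinfun (\<phi>' z))) (at z)" if "z \<in> S" for z
      using D\<phi> Blin that by simp
    show "continuous_on S (\<lambda>z. Blinfun (\<phi>' z))"
    proof (rule continuous_on_blinfun_componentwise)
      fix i :: "'a \<times> (real^'n)"
      have "continuous_on S (\<lambda>z. D z i)"
        unfolding D_def by (intro smooth_on_continuous_on smooth_on_frechet_derivative F)
      then have "continuous_on S (\<lambda>z. \<phi>' z i)"
        by (auto simp: \<phi>'_def intro: continuous_intros)
      then show "continuous_on S (\<lambda>z. blinfun_apply (Blinfun (\<phi>' z)) i)"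
        by (rule continuous_on_eq) (simp add: Blin)
    qed
    show "Blinfun (I z0) o\<^sub>L Blinfun (\<phi>' z0) = id_blinfun"
      using fun_cong[OF I_\<phi>'[OF \<open>z0 \<in> S\<close>]]
      by (intro blinfun_eqI) (simp add: Blin bounded_linear_Blinfun_apply[OF blI] \<open>z0 \<in> S\<close>)
  qed (use assms in auto)
  have gV: "g ` V \<subseteq> S" using hom U(2) by (auto simp: homeomorphism_def)
  have g'_I: "g' y = I (g y)" if "y \<in> V" for y
    using g'_eq[OF that] gV that Blin inv_\<phi>' by (simp add: image_subset_iff)
  have "Ck k V g" for k
  proof (induction k)
    case 0
    then show ?case using hom by (simp add: homeomorphism_def)
  next
    case (Suc k)
    \<comment> \<open>A derivative of \<open>F\<close> in a fixed direction is smooth on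
      \<open>S\<close>; composed with \<open>g\<close> it has the order that the induction
      hypothesis grants to \<open>g\<close>.\<close>
    have C: "Ck k V (\<lambda>y. D (g y) h)" for h
      unfolding D_def
      by (rule Ck_compose[OF \<open>open V\<close> \<open>open S\<close> gV Suc smooth_on_Ck[OF smooth_on_frechet_derivative[OF F]]])
    show ?case
    proof (rule Ck_SucI[OF \<open>open V\<close> g'])
      fix h
      have "Ck k V (\<lambda>y. I (g y) h)"
        unfolding I_def
      proof (intro Ck_Pair Ck_const \<open>open V\<close> Ck_matrix_inv_mult Ck_diff C)
        show "Ck k V (\<lambda>y. G (g y) $ i $ j)" for i j
          unfolding G_def matrix_def by simp (intro Ck_vec_nth \<open>open V\<close> C)
        show "det (G (g y)) \<noteq> 0" if "y \<in> V" for y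
          using inv[of "g y"] gV that by (simp add: invertible_det_nz image_subset_iff)
      qed
      then show "Ck k V (\<lambda>y. g' y h)"
        by (rule Ck_cong[OF \<open>open V\<close>, rotated]) (simp add: g'_I)
    qed
  qed
  then show thesis
    using that[OF U(1-4)] hom unfolding \<phi>_def smooth_on_def by blast
qed

text \<open>Links the hypothesis on g to the inverse function theorem: \<open>g_matrix\<close> is
  built from one-variable derivatives along coordinate lines in the fibre, and the chain rule
  identifies these with the fibre block of the Frechet derivative.\<close>

lemma g_matrix_eq_matrix:
  assumes "smooth_on S F" "z \<in> S"
  shows "g_matrix F z = matrix (\<lambda>k. frechet_derivative F (at z) (0, k))"
proof -
  obtain x v where z: "z = (x, v)" by force
  note F = smooth_on_has_derivative[OF assms]
  have "dv F s r z = frechet_derivative F (at z) (0, axis r 1) $ s" for s r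
  proof -
    have "((\<lambda>t::real. (x, v + t *\<^sub>R axis r 1)) has_derivative (\<lambda>t. (0, t *\<^sub>R axis r 1))) (at 0)"
      by (auto intro!: derivative_eq_intros)
    then have "((\<lambda>t. F (x, v + t *\<^sub>R axis r 1)) has_derivative
        (\<lambda>t. frechet_derivative F (at z) (0, t *\<^sub>R axis r 1))) (at 0)"
      by (rule has_derivative_compose) (use F z in simp)
    then have "((\<lambda>t. F (x, v + t *\<^sub>R axis r 1) $ s) has_derivative
        (\<lambda>t. frechet_derivative F (at z) (0, t *\<^sub>R axis r 1) $ s)) (at 0)"
      by (rule bounded_linear.has_derivative[OF bounded_linear_vec_nth])
    moreover have "frechet_derivative F (at z) (0, t *\<^sub>R axis r 1) $ s
        = frechet_derivative F (at z) (0, axis r 1) $ s * t" for t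
      using linear_scale[OF has_derivative_linear[OF F], of t "(0, axis r 1)"] by simp
    ultimately have "((\<lambda>t. F (x, v + t *\<^sub>R axis r 1) $ s) has_field_derivative
        frechet_derivative F (at z) (0, axis r 1) $ s) (at 0)"
      by (simp add: has_field_derivative_def mult_commute_abs)
    then show ?thesis
      by (simp add: dv_def z DERIV_imp_deriv)
  qed
  then show ?thesis
    by (simp add: g_matrix_def matrix_def)
qed

section \<open>Atlases\<close>

lemma inv_chart_eq: "inj_on (snd c) (fst c) \<Longrightarrow> p \<in> fst c \<Longrightarrow> inv_chart c (snd c p) = p"
  by (simp add: inv_chart_def the_inv_into_f_f)

lemma smooth_atlasD:
  assumes "smooth_atlas \<A>" "c \<in> \<A>"
  shows "inj_on (snd c) (fst c)" "open (snd c ` fst c)"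
    and "p \<in> fst c \<Longrightarrow> inv_chart c (snd c p) = p"
    and "d \<in> \<A> \<Longrightarrow> open (snd c ` (fst c \<inter> fst d))"
    and "d \<in> \<A> \<Longrightarrow> smooth_on (snd c ` (fst c \<inter> fst d)) (transition c d)"
proof -
  show inj: "inj_on (snd c) (fst c)" using assms by (simp add: smooth_atlas_def)
  show *: "d \<in> \<A> \<Longrightarrow> open (snd c ` (fst c \<inter> fst d))"
    "d \<in> \<A> \<Longrightarrow> smooth_on (snd c ` (fst c \<inter> fst d)) (transition c d)" for d
    using assms by (simp_all add: smooth_atlas_def)
  show "open (snd c ` fst c)" using *(1)[OF assms(2)] by simp
  show "p \<in> fst c \<Longrightarrow> inv_chart c (snd c p) = p" by (rule inv_chart_eq[OF inj])
qed

lemma transition_eq: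
  "smooth_atlas \<A> \<Longrightarrow> c \<in> \<A> \<Longrightarrow> p \<in> fst c \<Longrightarrow> transition c d (snd c p) = snd d p"
  by (simp add: transition_def smooth_atlasD)

text \<open>\<open>topology\<close> has the intended open sets once its predicate satisfies
  \<open>istopology\<close>. The critical case is binary intersection: images commute with it
  because charts are injective.\<close>

lemma openin_atlas_topology:
  assumes "smooth_atlas \<A>"
  shows "openin (atlas_topology \<A>) W \<longleftrightarrow>
    W \<subseteq> carrier_of \<A> \<and> (\<forall>c\<in>\<A>. open (snd c ` (W \<inter> fst c)))"
proof -
  have "istopology (\<lambda>W. W \<subseteq> carrier_of \<A> \<and> (\<forall>c\<in>\<A>. open (snd c ` (W \<inter> fst c))))"
    unfolding istopology_def
  proof (intro conjI allI impI; (elim conjE)?)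
    fix S T assume S: "S \<subseteq> carrier_of \<A>" "\<forall>c\<in>\<A>. open (snd c ` (S \<inter> fst c))"
      and T: "T \<subseteq> carrier_of \<A>" "\<forall>c\<in>\<A>. open (snd c ` (T \<inter> fst c))"
    show "S \<inter> T \<subseteq> carrier_of \<A>" using S by blast
    show "\<forall>c\<in>\<A>. open (snd c ` (S \<inter> T \<inter> fst c))"
    proof
      fix c assume c: "c \<in> \<A>"
      have "snd c ` (S \<inter> T \<inter> fst c) = snd c ` (S \<inter> fst c) \<inter> snd c ` (T \<inter> fst c)"
        using smooth_atlasD(1)[OF assms c] unfolding inj_on_def by blast
      then show "open (snd c ` (S \<inter> T \<inter> fst c))" using S T c by (simp add: open_Int)
    qed
  next
    fix K assume K: "\<forall>S\<in>K. S \<subseteq> carrier_of \<A> \<and> (\<forall>c\<in>\<A>. open (snd c ` (S \<inter> fst c)))"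
    then show "\<Union>K \<subseteq> carrier_of \<A>" by blast
    show "\<forall>c\<in>\<A>. open (snd c ` (\<Union>K \<inter> fst c))"
    proof
      fix c assume c: "c \<in> \<A>"
      have "snd c ` (\<Union>K \<inter> fst c) = (\<Union>S\<in>K. snd c ` (S \<inter> fst c))" by blast
      moreover have "open (\<Union>S\<in>K. snd c ` (S \<inter> fst c))"
        by (rule open_UN) (use K c in blast)
      ultimately show "open (snd c ` (\<Union>K \<inter> fst c))" by simp
    qed
  qed
  then show ?thesis by (simp add: atlas_topology_def topology_inverse')
qed

lemma topspace_atlas_topology:
  assumes "smooth_atlas \<A>"
  shows "topspace (atlas_topology \<A>) = carrier_of \<A>"
proof -
  have "carrier_of \<A> \<inter> fst c = fst c" if "c \<in> \<A>" for c
    using that by (auto simp: carrier_of_def)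
  then have "openin (atlas_topology \<A>) (carrier_of \<A>)"
    using assms by (simp add: openin_atlas_topology smooth_atlasD)
  moreover have "W \<subseteq> carrier_of \<A>" if "openin (atlas_topology \<A>) W" for W
    using that assms by (simp add: openin_atlas_topology)
  ultimately show ?thesis
    by (meson openin_subset openin_topspace subset_antisym)
qed

text \<open>Read in another chart \<open>d\<close>, the set is the preimage of \<open>U\<close>
  under a transition map, which is continuous on an open set. Domains and images of the local
  diffeomorphisms will be sets of this kind.\<close>

lemma openin_chart_vimage:
  assumes \<A>: "smooth_atlas \<A>" and c: "c \<in> \<A>" and U: "open U"
  shows "openin (atlas_topology \<A>) {q \<in> fst c. snd c q \<in> U}"
  unfolding openin_atlas_topology[OF \<A>]
proof (intro conjI ballI)
  show "{q \<in> fst c. snd c q \<in> U} \<subseteq> carrier_of \<A>" using c by (auto simp: carrier_of_def)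
  fix d assume d: "d \<in> \<A>"
  have "snd d ` ({q \<in> fst c. snd c q \<in> U} \<inter> fst d)
      = snd d ` (fst d \<inter> fst c) \<inter> transition d c -` U"
    using transition_eq[OF \<A> d, of _ c] by auto
  moreover have "open (snd d ` (fst d \<inter> fst c) \<inter> transition d c -` U)"
    by (intro continuous_open_preimage smooth_on_continuous_on smooth_atlasD[OF \<A> d] c U)
  ultimately show "open (snd d ` ({q \<in> fst c. snd c q \<in> U} \<inter> fst d))" by simp
qed

text \<open>In arbitrary charts around a point the representative is the given one composed with
  transitions on both sides. The work lies in finding an open set \<open>T\<close> on which the
  composition is defined.\<close>

lemma smooth_map_localI:
  fixes \<A> :: "('a, 'e::euclidean_space) atlas" and \<B> :: "('b, 'f::euclidean_space) atlas"
  assumes \<A>: "smooth_atlas \<A>" and \<B>: "smooth_atlas \<B>"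
    and local: "\<And>q. q \<in> carrier_of \<A> \<Longrightarrow> \<exists>c\<in>\<A>. \<exists>d\<in>\<B>. \<exists>Z. open Z \<and> Z \<subseteq> snd c ` fst c \<and>
      q \<in> fst c \<and> snd c q \<in> Z \<and> (\<forall>z\<in>Z. f (inv_chart c z) \<in> fst d) \<and>
      smooth_on Z (snd d \<circ> f \<circ> inv_chart c)"
  shows "smooth_map \<A> \<B> f"
proof -
  have key: "\<exists>T. open T \<and> snd c q \<in> T \<and> T \<subseteq> snd c ` (fst c \<inter> f -` fst d) \<and>
      smooth_on T (snd d \<circ> f \<circ> inv_chart c)"
    if c: "c \<in> \<A>" and d: "d \<in> \<B>" and q: "q \<in> fst c" "f q \<in> fst d" for c d q
  proof -
    have "q \<in> carrier_of \<A>" using c q by (auto simp: carrier_of_def)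
    from local[OF this] obtain c0 d0 Z where c0: "c0 \<in> \<A>" and d0: "d0 \<in> \<B>" and Z: "open Z" "Z \<subseteq> snd c0 ` fst c0"
      and q0: "q \<in> fst c0" "snd c0 q \<in> Z" and fZ: "\<And>z. z \<in> Z \<Longrightarrow> f (inv_chart c0 z) \<in> fst d0"
      and sm: "smooth_on Z (snd d0 \<circ> f \<circ> inv_chart c0)"
      by blast
    define T1 where "T1 = snd c ` (fst c \<inter> fst c0) \<inter> transition c c0 -` Z"
    define rep where "rep = (\<lambda>z. (snd d0 \<circ> f \<circ> inv_chart c0) (transition c c0 z))"
    \<comment> \<open>Continuity of \<open>f\<close> between the manifolds is not yet known, so the
      points sent into \<open>d\<close> are selected through the representative \<open>rep\<close>,
      whose continuity is known.\<close>
    define T where "T = T1 \<inter> rep -` (snd d0 ` (fst d0 \<inter> fst d))"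
    have T1: "open T1"
      unfolding T1_def
      by (intro continuous_open_preimage smooth_on_continuous_on smooth_atlasD[OF \<A> c] c0 Z)
    have "smooth_on T1 (transition c c0)"
      by (rule smooth_on_subset[OF smooth_atlasD(5)[OF \<A> c c0]]) (auto simp: T1_def)
    then have rep: "smooth_on T1 rep"
      unfolding rep_def by (intro smooth_on_compose[OF T1 Z(1) _ _ sm]) (auto simp: T1_def)
    have T: "open T"
      unfolding T_def
      by (intro continuous_open_preimage smooth_on_continuous_on rep T1 smooth_atlasD(4)[OF \<B> d0 d])
    have on_T: "\<exists>p. z = snd c p \<and> p \<in> fst c \<and> p \<in> fst c0 \<and> f p \<in> fst d0 \<and> f p \<in> fst d \<and> rep z = snd d0 (f p)"
      if z: "z \<in> T" for z
    proof -
      obtain p where p: "z = snd c p" "p \<in> fst c" "p \<in> fst c0" and "transition c c0 z \<in> Z"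
        using z by (auto simp: T_def T1_def)
      then have "snd c0 p \<in> Z" by (simp add: transition_eq[OF \<A> c])
      then have fp: "f p \<in> fst d0" using fZ[of "snd c0 p"] p(3) by (simp add: smooth_atlasD(3)[OF \<A> c0])
      have rz: "rep z = snd d0 (f p)"
        using p by (simp add: rep_def transition_eq[OF \<A> c] smooth_atlasD(3)[OF \<A> c0])
      moreover have "rep z \<in> snd d0 ` (fst d0 \<inter> fst d)" using z by (simp add: T_def)
      \<comment> \<open>Injectivity of the chart \<open>d0\<close> turns membership of coordinates
        into membership of the point \<open>f p\<close>.\<close>
      ultimately have "f p \<in> fst d"
        using smooth_atlasD(1)[OF \<B> d0] fp by (auto simp: inj_on_def)
      then show ?thesis using p fp rz by blast
    qed
    have "smooth_on T (\<lambda>z. transition d0 d (rep z))"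
      by (rule smooth_on_compose[OF T smooth_atlasD(4)[OF \<B> d0 d] _
            smooth_on_subset[OF rep] smooth_atlasD(5)[OF \<B> d0 d]]) (auto simp: T_def)
    moreover have "transition d0 d (rep z) = (snd d \<circ> f \<circ> inv_chart c) z" if "z \<in> T" for z
      using on_T[OF that] by (auto simp: transition_eq[OF \<B> d0] smooth_atlasD(3)[OF \<A> c])
    ultimately have "smooth_on T (snd d \<circ> f \<circ> inv_chart c)"
      by (rule smooth_on_cong[OF T, rotated])
    moreover have "snd c q \<in> T"
    proof -
      have "f q \<in> fst d0" using fZ[OF q0(2)] q0(1) by (simp add: smooth_atlasD(3)[OF \<A> c0])
      then show ?thesis
        using q q0 by (auto simp: T_def T1_def rep_def transition_eq[OF \<A> c] smooth_atlasD(3)[OF \<A> c0])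
    qed
    moreover have "T \<subseteq> snd c ` (fst c \<inter> f -` fst d)" using on_T by blast
    ultimately show ?thesis using T by blast
  qed
  have maps: "f q \<in> carrier_of \<B>" if "q \<in> carrier_of \<A>" for q
  proof -
    from local[OF that] obtain c d Z where "c \<in> \<A>" "d \<in> \<B>" "q \<in> fst c" "snd c q \<in> Z" "\<And>z. z \<in> Z \<Longrightarrow> f (inv_chart c z) \<in> fst d"
      by blast
    then have "f q \<in> fst d" using smooth_atlasD(3)[OF \<A> \<open>c \<in> \<A>\<close>] by metis
    then show ?thesis using \<open>d \<in> \<B>\<close> by (auto simp: carrier_of_def)
  qed
  have "continuous_map (atlas_topology \<A>) (atlas_topology \<B>) f"
    unfolding continuous_map_def topspace_atlas_topology[OF \<A>] topspace_atlas_topology[OF \<B>]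
  proof (intro conjI allI impI)
    show "f \<in> carrier_of \<A> \<rightarrow> carrier_of \<B>" using maps by blast
    fix V assume "openin (atlas_topology \<B>) V"
    then have V: "V \<subseteq> carrier_of \<B>" "\<And>d. d \<in> \<B> \<Longrightarrow> open (snd d ` (V \<inter> fst d))"
      by (simp_all add: openin_atlas_topology[OF \<B>])
    show "openin (atlas_topology \<A>) {q \<in> carrier_of \<A>. f q \<in> V}"
      unfolding openin_atlas_topology[OF \<A>]
    proof (intro conjI ballI)
      fix c assume c: "c \<in> \<A>"
      \<comment> \<open>Openness is tested point by point: around \<open>z\<close> the set contains
        the preimage of an open coordinate set under a continuous representative of
        \<open>f\<close>.\<close>
      show "open (snd c ` ({q \<in> carrier_of \<A>. f q \<in> V} \<inter> fst c))"
      proof (subst open_subopen, rule ballI)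
        fix z assume "z \<in> snd c ` ({q \<in> carrier_of \<A>. f q \<in> V} \<inter> fst c)"
        then obtain q where q: "z = snd c q" "q \<in> fst c" "f q \<in> V" by blast
        then obtain d where d: "d \<in> \<B>" "f q \<in> fst d" using V(1) by (auto simp: carrier_of_def)
        obtain T where T: "open T" "snd c q \<in> T" "T \<subseteq> snd c ` (fst c \<inter> f -` fst d)"
          "smooth_on T (snd d \<circ> f \<circ> inv_chart c)"
          using key[OF c d(1) q(2) d(2)] by blast
        let ?T = "T \<inter> (snd d \<circ> f \<circ> inv_chart c) -` (snd d ` (V \<inter> fst d))"
        have "open ?T"
          by (intro continuous_open_preimage smooth_on_continuous_on T V d)
        moreover have "z \<in> ?T"
          using T(2) q d(2) by (auto simp: smooth_atlasD(3)[OF \<A> c])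
        moreover have "?T \<subseteq> snd c ` ({q \<in> carrier_of \<A>. f q \<in> V} \<inter> fst c)"
        proof
          fix z' assume z': "z' \<in> ?T"
          then obtain p where p: "z' = snd c p" "p \<in> fst c" "f p \<in> fst d" using T(3) by blast
          with z' have "snd d (f p) \<in> snd d ` (V \<inter> fst d)" by (simp add: smooth_atlasD(3)[OF \<A> c])
          then have "f p \<in> V" using p(3) smooth_atlasD(1)[OF \<B> d(1)] by (auto simp: inj_on_def)
          then show "z' \<in> snd c ` ({q \<in> carrier_of \<A>. f q \<in> V} \<inter> fst c)"
            using p c by (auto simp: carrier_of_def)
        qed
        ultimately show "\<exists>T. open T \<and> z \<in> T \<and> T \<subseteq> snd c ` ({q \<in> carrier_of \<A>. f q \<in> V} \<inter> fst c)"
          by blast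
      qed
    qed blast
  qed
  moreover have "smooth_on (snd c ` (fst c \<inter> f -` fst d)) (snd d \<circ> f \<circ> inv_chart c)"
    if "c \<in> \<A>" "d \<in> \<B>" for c d
    by (rule smooth_on_local) (use key[OF that] in blast)
  ultimately show ?thesis by (simp add: smooth_map_def)
qed

section \<open>Restricted atlases and local diffeomorphisms\<close>

lemma carrier_of_restrict_atlas: "carrier_of (restrict_atlas \<A> W) = carrier_of \<A> \<inter> W"
  by (auto simp: carrier_of_def restrict_atlas_def)

text \<open>\<open>inv_chart\<close> depends on the domain of the chart, so shrinking the domain
  formally changes the function. Injectivity forces the same values on the smaller image.\<close>

lemma inv_chart_restrict:
  assumes "smooth_atlas \<A>" "c \<in> \<A>" "p \<in> fst c \<inter> W"
  shows "inv_chart (fst c \<inter> W, snd c) (snd c p) = p"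
  using assms(3) inv_chart_eq[of "(fst c \<inter> W, snd c)" p]
    inj_on_subset[OF smooth_atlasD(1)[OF assms(1,2)], of "fst c \<inter> W"] by simp

lemma smooth_atlas_restrict_atlas:
  assumes \<A>: "smooth_atlas \<A>" and W: "openin (atlas_topology \<A>) W"
  shows "smooth_atlas (restrict_atlas \<A> W)"
proof -
  have "open (snd c ` ((fst c \<inter> W) \<inter> (fst d \<inter> W))) \<and>
      smooth_on (snd c ` ((fst c \<inter> W) \<inter> (fst d \<inter> W))) (transition (fst c \<inter> W, snd c) (fst d \<inter> W, snd d))"
    if c: "c \<in> \<A>" and d: "d \<in> \<A>" for c d
  proof -
    let ?S = "snd c ` ((fst c \<inter> W) \<inter> (fst d \<inter> W))"
    have "?S = snd c ` (fst c \<inter> fst d) \<inter> snd c ` (W \<inter> fst c)"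
      using smooth_atlasD(1)[OF \<A> c] unfolding inj_on_def by blast
    then have S: "open ?S"
      using W smooth_atlasD(4)[OF \<A> c d] c by (simp add: openin_atlas_topology[OF \<A>] open_Int)
    have "smooth_on ?S (transition c d)"
      by (rule smooth_on_subset[OF smooth_atlasD(5)[OF \<A> c d]]) blast
    then have "smooth_on ?S (transition (fst c \<inter> W, snd c) (fst d \<inter> W, snd d))"
      by (rule smooth_on_cong[OF S, rotated])
        (auto simp: transition_def smooth_atlasD(3)[OF \<A> c] inv_chart_restrict[OF \<A> c])
    with S show ?thesis by simp
  qed
  moreover have "inj_on (snd c) (fst c \<inter> W)" if "c \<in> \<A>" for c
    using smooth_atlasD(1)[OF \<A> that] by (rule inj_on_subset) blast
  ultimately show ?thesis
    by (simp add: smooth_atlas_def restrict_atlas_def)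
qed

text \<open>A homeomorphism of coordinate sets is lifted to the manifolds: \<open>U\<close> and
  \<open>V\<close> pull back to open sets that \<open>f\<close> matches bijectively, and
  \<open>g\<close> becomes the representative of the inverse map. Smoothness in both directions is
  then an instance of \<open>smooth_map_localI\<close> for the restricted atlases.\<close>

lemma local_diffeomorphismI:
  fixes \<A> :: "('a, 'e::euclidean_space) atlas" and \<B> :: "('b, 'f::euclidean_space) atlas"
  assumes \<A>: "smooth_atlas \<A>" and \<B>: "smooth_atlas \<B>"
    and local: "\<And>q. q \<in> carrier_of \<A> \<Longrightarrow> \<exists>c\<in>\<A>. \<exists>d\<in>\<B>. \<exists>U V g. open U \<and> U \<subseteq> snd c ` fst c \<and>
      q \<in> fst c \<and> snd c q \<in> U \<and> open V \<and> (\<forall>z\<in>U. f (inv_chart c z) \<in> fst d) \<and>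
      homeomorphism U V (snd d \<circ> f \<circ> inv_chart c) g \<and>
      smooth_on U (snd d \<circ> f \<circ> inv_chart c) \<and> smooth_on V g"
  shows "local_diffeomorphism \<A> \<B> f"
  unfolding local_diffeomorphism_def
proof
  fix q assume "q \<in> carrier_of \<A>"
  from local[OF this] obtain c d U V g where c: "c \<in> \<A>" and d: "d \<in> \<B>" and U: "open U" "U \<subseteq> snd c ` fst c"
    and q: "q \<in> fst c" "snd c q \<in> U" and V: "open V" and fU: "\<And>z. z \<in> U \<Longrightarrow> f (inv_chart c z) \<in> fst d"
    and hom: "homeomorphism U V (snd d \<circ> f \<circ> inv_chart c) g"
    and sm: "smooth_on U (snd d \<circ> f \<circ> inv_chart c)" "smooth_on V g"
    by blast
  define W where "W = {q \<in> fst c. snd c q \<in> U}"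
  have W_carrier: "W \<subseteq> carrier_of \<A>" using c by (auto simp: W_def carrier_of_def)
  have fW: "f p \<in> fst d" "snd d (f p) \<in> V" "g (snd d (f p)) = snd c p" if "p \<in> W" for p
  proof -
    have p: "snd c p \<in> U" "inv_chart c (snd c p) = p"
      using that smooth_atlasD(3)[OF \<A> c] by (auto simp: W_def)
    have "(snd d \<circ> f \<circ> inv_chart c) (snd c p) \<in> V"
      using homeomorphism_image1[OF hom] p(1) by blast
    with p fU[OF p(1)] homeomorphism_apply1[OF hom p(1)]
    show "f p \<in> fst d" "snd d (f p) \<in> V" "g (snd d (f p)) = snd c p"
      by simp_all
  qed
  \<comment> \<open>Identifying the image with the chart preimage of \<open>V\<close> yields its
    openness without an open mapping argument on the manifold.\<close>
  have fW_eq: "f ` W = {r \<in> fst d. snd d r \<in> V}"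
  proof (intro equalityI subsetI)
    fix r assume r: "r \<in> {r \<in> fst d. snd d r \<in> V}"
    then obtain u where u: "u \<in> U" "snd d r = snd d (f (inv_chart c u))"
      using hom by (auto simp: homeomorphism_def)
    then have "r = f (inv_chart c u)"
      using r fU smooth_atlasD(1)[OF \<B> d] by (auto simp: inj_on_def)
    moreover have "inv_chart c u \<in> W"
      using u(1) U(2) by (auto simp: W_def smooth_atlasD(3)[OF \<A> c])
    ultimately show "r \<in> f ` W" by blast
  qed (use fW in auto)
  \<comment> \<open>\<open>g\<close> reconstructs the coordinates of a point of \<open>W\<close>
    from those of its image.\<close>
  have inj: "inj_on f W"
  proof (rule inj_onI)
    fix p p' assume "p \<in> W" "p' \<in> W" "f p = f p'"
    then have "snd c p = snd c p'" using fW(3) by metis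
    then show "p = p'" using \<open>p \<in> W\<close> \<open>p' \<in> W\<close> smooth_atlasD(1)[OF \<A> c] by (auto simp: W_def inj_on_def)
  qed
  have W_open: "openin (atlas_topology \<A>) W"
    unfolding W_def by (rule openin_chart_vimage[OF \<A> c U(1)])
  have fW_open: "openin (atlas_topology \<B>) (f ` W)"
    unfolding fW_eq by (rule openin_chart_vimage[OF \<B> d V])
  have fW_carrier: "f ` W \<subseteq> carrier_of \<B>" using fW_open by (simp add: openin_atlas_topology[OF \<B>])
  let ?\<A> = "restrict_atlas \<A> W" and ?\<B> = "restrict_atlas \<B> (f ` W)"
  let ?c = "(fst c \<inter> W, snd c)" and ?d = "(fst d \<inter> f ` W, snd d)"
  note at = smooth_atlas_restrict_atlas[OF \<A> W_open] smooth_atlas_restrict_atlas[OF \<B> fW_open]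
  have carriers: "carrier_of ?\<A> = W" "carrier_of ?\<B> = f ` W"
    using W_carrier fW_carrier by (auto simp: carrier_of_restrict_atlas)
  have cd: "?c \<in> ?\<A>" "?d \<in> ?\<B>" using c d by (auto simp: restrict_atlas_def)
  have U_W: "\<exists>p\<in>W. z = snd c p" if "z \<in> U" for z
    using that U(2) by (auto simp: W_def)
  have V_W: "\<exists>p\<in>W. z = snd d (f p)" if "z \<in> V" for z
    using that hom U_W smooth_atlasD(3)[OF \<A> c] unfolding homeomorphism_def
    by (force simp: W_def)
  have inv_c: "inv_chart ?c (snd c p) = p" if "p \<in> W" for p
    by (rule inv_chart_restrict[OF \<A> c]) (use that in \<open>auto simp: W_def\<close>)
  have inv_d: "inv_chart ?d (snd d (f p)) = f p" if "p \<in> W" for p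
    by (rule inv_chart_restrict[OF \<B> d]) (use that fW in auto)
  have h: "the_inv_into W f (f p) = p" if "p \<in> W" for p
    using the_inv_into_f_f[OF inj that] .
  have "smooth_map ?\<A> ?\<B> f"
  proof (rule smooth_map_localI[OF at])
    fix p assume "p \<in> carrier_of ?\<A>"
    then have p: "p \<in> W" by (simp add: carriers)
    have "smooth_on U (snd ?d \<circ> f \<circ> inv_chart ?c)"
      by (rule smooth_on_cong[OF U(1) _ sm(1)])
        (use U_W inv_c smooth_atlasD(3)[OF \<A> c] in \<open>fastforce simp: W_def\<close>)
    moreover have "\<forall>z\<in>U. f (inv_chart ?c z) \<in> fst ?d"
      using U_W inv_c fW by fastforce
    moreover have "U \<subseteq> snd ?c ` fst ?c" using U(2) by (auto simp: W_def)
    ultimately show "\<exists>c\<in>?\<A>. \<exists>d\<in>?\<B>. \<exists>Z. open Z \<and> Z \<subseteq> snd c ` fst c \<and>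
        p \<in> fst c \<and> snd c p \<in> Z \<and> (\<forall>z\<in>Z. f (inv_chart c z) \<in> fst d) \<and>
        smooth_on Z (snd d \<circ> f \<circ> inv_chart c)"
      using p U(1) by (intro bexI[OF _ cd(1)] bexI[OF _ cd(2)] exI[of _ U]) (auto simp: W_def)
  qed
  moreover have "smooth_map ?\<B> ?\<A> (the_inv_into W f)"
  proof (rule smooth_map_localI[OF at(2,1)])
    fix r assume "r \<in> carrier_of ?\<B>"
    then have r: "r \<in> f ` W" by (simp add: carriers)
    have "smooth_on V (snd ?c \<circ> the_inv_into W f \<circ> inv_chart ?d)"
    proof (rule smooth_on_cong[OF V _ sm(2)])
      fix z assume "z \<in> V"
      then obtain p where "p \<in> W" "z = snd d (f p)" using V_W by blast
      then show "g z = (snd ?c \<circ> the_inv_into W f \<circ> inv_chart ?d) z"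
        by (simp add: fW inv_d h)
    qed
    moreover have "\<forall>z\<in>V. the_inv_into W f (inv_chart ?d z) \<in> fst ?c"
    proof
      fix z assume "z \<in> V"
      then obtain p where "p \<in> W" "z = snd d (f p)" using V_W by blast
      then show "the_inv_into W f (inv_chart ?d z) \<in> fst ?c"
        by (simp add: inv_d h) (simp add: W_def)
    qed
    moreover have "V \<subseteq> snd ?d ` fst ?d" using V_W fW by fastforce
    ultimately show "\<exists>c\<in>?\<B>. \<exists>d\<in>?\<A>. \<exists>Z. open Z \<and> Z \<subseteq> snd c ` fst c \<and>
        r \<in> fst c \<and> snd c r \<in> Z \<and> (\<forall>z\<in>Z. the_inv_into W f (inv_chart c z) \<in> fst d) \<and>
        smooth_on Z (snd d \<circ> the_inv_into W f \<circ> inv_chart c)"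
      using r V fW by (intro bexI[OF _ cd(1)] bexI[OF _ cd(2)] exI[of _ V]) auto
  qed
  ultimately have "diffeomorphism ?\<A> ?\<B> f"
    using inj by (simp add: diffeomorphism_def carriers inj_on_imp_bij_betw)
  then show "\<exists>W. openin (atlas_topology \<A>) W \<and> q \<in> W \<and> openin (atlas_topology \<B>) (f ` W) \<and>
      diffeomorphism (restrict_atlas \<A> W) (restrict_atlas \<B> (f ` W)) f"
    using W_open fW_open q by (intro exI[of _ W]) (auto simp: W_def)
qed

section \<open>Tangent and cotangent bundles\<close>

context
  fixes M :: "('m, real^'n) atlas"
  assumes M: "smooth_atlas M"
begin

section \<open>Jacobians of coordinate changes\<close>

lemma transition_has_derivative:
  assumes "c \<in> M" "d \<in> M" "p \<in> fst c" "p \<in> fst d"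
  shows "(transition c d has_derivative (\<lambda>h. jac c d p *v h)) (at (snd c p))"
proof -
  have "transition c d differentiable at (snd c p)"
    using smooth_on_has_derivative[OF smooth_atlasD(5)[OF M assms(1,2)], of "snd c p"] assms(3,4)
    by (auto simp: differentiable_def)
  then show ?thesis by (simp add: jacobian_works jac_def)
qed

text \<open>\<open>jac\<close> takes a point of the manifold, whereas smoothness of bundle
  transitions is a statement about functions of coordinates; this form makes the coordinate
  dependence visible.\<close>

lemma jac_mult_eq_frechet_derivative:
  assumes "c \<in> M" "d \<in> M" "p \<in> fst c" "p \<in> fst d"
  shows "jac c d p *v h = frechet_derivative (transition c d) (at (snd c p)) h"
  using frechet_derivative_at[OF transition_has_derivative[OF assms]] by metis

text \<open>The chain rule on the triple overlap, where two successive coordinate changes compose to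
  the direct one. The overlap is open in coordinates, so agreement there determines the
  derivative.\<close>

lemma jac_cocycle:
  assumes c: "c \<in> M" "p \<in> fst c" and d: "d \<in> M" "p \<in> fst d" and e: "e \<in> M" "p \<in> fst e"
  shows "jac d e p ** jac c d p = jac c e p"
proof -
  let ?T = "snd c ` (fst c \<inter> fst d \<inter> fst e)"
  have "?T = snd c ` (fst c \<inter> fst d) \<inter> snd c ` (fst c \<inter> fst e)"
    using smooth_atlasD(1)[OF M c(1)] unfolding inj_on_def by blast
  then have T: "open ?T" "snd c p \<in> ?T"
    using c d e by (simp_all add: open_Int smooth_atlasD(4)[OF M])
  have "((\<lambda>x. transition d e (transition c d x)) has_derivative
      (\<lambda>h. jac d e p *v (jac c d p *v h))) (at (snd c p))"
    by (rule has_derivative_compose[OF transition_has_derivative])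
      (use assms transition_has_derivative[OF d(1) e(1) d(2) e(2)] in \<open>simp_all add: transition_eq[OF M]\<close>)
  then have "(transition c e has_derivative (\<lambda>h. jac d e p *v (jac c d p *v h))) (at (snd c p))"
    by (rule has_derivative_transform_within_open[OF _ T])
      (auto simp: transition_eq[OF M] c d)
  then have "(\<lambda>h. jac d e p *v (jac c d p *v h)) = (\<lambda>h. jac c e p *v h)"
    using transition_has_derivative[OF c(1) e(1) c(2) e(2)] has_derivative_unique by blast
  then show ?thesis
    by (simp add: matrix_eq fun_eq_iff matrix_vector_mul_assoc)
qed

lemma jac_self:
  assumes "c \<in> M" "p \<in> fst c"
  shows "jac c c p = mat 1"
proof -
  have "(transition c c has_derivative (\<lambda>h. h)) (at (snd c p))"
    by (rule has_derivative_transform_within_open[OF has_derivative_ident smooth_atlasD(2)[OF M assms(1)]])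
      (use assms in \<open>auto simp: transition_eq[OF M]\<close>)
  then have "(\<lambda>h. jac c c p *v h) = (\<lambda>h. h)"
    using transition_has_derivative[OF assms(1,1) assms(2,2)] has_derivative_unique by blast
  then show ?thesis by (simp add: matrix_eq fun_eq_iff)
qed

text \<open>The Jacobians spread \<open>v\<close> from \<open>c\<close> to all charts around
  \<open>p\<close>, and the cocycle identity is the required transformation law. Hence bundle charts
  reach every point of the model fibre.\<close>

lemma tangent_space_exists:
  assumes "c \<in> M" "p \<in> fst c"
  shows "\<exists>u\<in>tangent_space M p. u c = v"
proof -
  let ?u = "\<lambda>d. if d \<in> M \<and> p \<in> fst d then jac c d p *v v else 0"
  have "?u c = v" using assms by (simp add: jac_self)
  moreover have "?u \<in> tangent_space M p"
    using assms by (auto simp: tangent_space_def matrix_vector_mul_assoc jac_cocycle)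
  ultimately show ?thesis by (rule bexI)
qed

lemma cotangent_space_exists:
  assumes "c \<in> M" "p \<in> fst c"
  shows "\<exists>\<omega>\<in>cotangent_space M p. \<omega> c = w"
proof -
  \<comment> \<open>Covectors transform contragrediently: components in \<open>d\<close> come from
    those in \<open>c\<close> through the transposed Jacobian of the reverse change, from
    \<open>d\<close> to \<open>c\<close>.\<close>
  let ?w = "\<lambda>d. if d \<in> M \<and> p \<in> fst d then transpose (jac d c p) *v w else 0"
  have "?w c = w" using assms by (simp add: jac_self transpose_mat)
  moreover have "?w \<in> cotangent_space M p"
    using assms
    by (auto simp: cotangent_space_def vector_matrix_mul_assoc jac_cocycle)
  ultimately show ?thesis by (rule bexI)
qed

lemma tangent_spaceD:
  assumes "u \<in> tangent_space M p" "c \<in> M" "d \<in> M" "p \<in> fst c" "p \<in> fst d"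
  shows "u d = jac c d p *v u c"
  using assms unfolding tangent_space_def by blast

lemma cotangent_spaceD:
  assumes "u \<in> cotangent_space M p" "c \<in> M" "d \<in> M" "p \<in> fst c" "p \<in> fst d"
  shows "u d = transpose (jac d c p) *v u c"
  using assms unfolding cotangent_space_def by blast

text \<open>The transformation law fixes the components in all charts around \<open>p\<close>, and
  the default 0 fixes the remaining values. This makes the bundle charts injective.\<close>

lemma tangent_space_eqI:
  assumes "c \<in> M" "p \<in> fst c" "u \<in> tangent_space M p" "u' \<in> tangent_space M p" "u c = u' c"
  shows "u = u'"
proof
  fix d show "u d = u' d"
  proof (cases "d \<in> M \<and> p \<in> fst d")
    case True
    then show ?thesis using assms by (simp add: tangent_spaceD[of _ p c d])
  next
    case False
    then have "u d = 0" "u' d = 0" using assms(3,4) unfolding tangent_space_def by blast+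
    then show ?thesis by simp
  qed
qed

lemma cotangent_space_eqI:
  assumes "c \<in> M" "p \<in> fst c" "u \<in> cotangent_space M p" "u' \<in> cotangent_space M p" "u c = u' c"
  shows "u = u'"
proof
  fix d show "u d = u' d"
  proof (cases "d \<in> M \<and> p \<in> fst d")
    case True
    then show ?thesis using assms by (simp add: cotangent_spaceD[of _ p c d])
  next
    case False
    then have "u d = 0" "u' d = 0" using assms(3,4) unfolding cotangent_space_def by blast+
    then show ?thesis by simp
  qed
qed

section \<open>Bundle charts and their coordinate changes\<close>

lemma tangent_chart_inj: "c \<in> M \<Longrightarrow> inj_on (snd (tangent_chart M c)) (fst (tangent_chart M c))"
  using smooth_atlasD(1)[OF M] unfolding inj_on_def
  by (simp add: tangent_chart_def split_beta) (metis prod.collapse tangent_space_eqI)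

lemma cotangent_chart_inj: "c \<in> M \<Longrightarrow> inj_on (snd (cotangent_chart M c)) (fst (cotangent_chart M c))"
  using smooth_atlasD(1)[OF M] unfolding inj_on_def
  by (simp add: cotangent_chart_def split_beta) (metis prod.collapse cotangent_space_eqI)

lemma tangent_chart_image:
  assumes "c \<in> M"
  shows "snd (tangent_chart M c) ` (fst (tangent_chart M c) \<inter> fst (tangent_chart M d))
    = snd c ` (fst c \<inter> fst d) \<times> UNIV"
proof (intro equalityI subsetI)
  fix z assume "z \<in> snd c ` (fst c \<inter> fst d) \<times> (UNIV :: (real^'n) set)"
  then obtain p v where p: "z = (snd c p, v)" "p \<in> fst c" "p \<in> fst d" by auto
  with tangent_space_exists[OF assms p(2), of v] obtain u
    where u: "u \<in> tangent_space M p" "u c = v" by blast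
  show "z \<in> snd (tangent_chart M c) ` (fst (tangent_chart M c) \<inter> fst (tangent_chart M d))"
    by (rule image_eqI[of _ _ "(p, u)"]) (use p u in \<open>simp_all add: tangent_chart_def\<close>)
qed (auto simp: tangent_chart_def)

lemma cotangent_chart_image:
  assumes "c \<in> M"
  shows "snd (cotangent_chart M c) ` (fst (cotangent_chart M c) \<inter> fst (cotangent_chart M d))
    = snd c ` (fst c \<inter> fst d) \<times> UNIV"
proof (intro equalityI subsetI)
  fix z assume "z \<in> snd c ` (fst c \<inter> fst d) \<times> (UNIV :: (real^'n) set)"
  then obtain p v where p: "z = (snd c p, v)" "p \<in> fst c" "p \<in> fst d" by auto
  with cotangent_space_exists[OF assms p(2), of v] obtain u
    where u: "u \<in> cotangent_space M p" "u c = v" by blast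
  show "z \<in> snd (cotangent_chart M c) ` (fst (cotangent_chart M c) \<inter> fst (cotangent_chart M d))"
    by (rule image_eqI[of _ _ "(p, u)"]) (use p u in \<open>simp_all add: cotangent_chart_def\<close>)
qed (auto simp: cotangent_chart_def)

lemma tangent_transition:
  assumes "c \<in> M" "d \<in> M" "z \<in> snd c ` (fst c \<inter> fst d) \<times> UNIV"
  shows "transition (tangent_chart M c) (tangent_chart M d) z =
    (transition c d (fst z), frechet_derivative (transition c d) (at (fst z)) (snd z))"
proof -
  obtain q where q: "q \<in> fst (tangent_chart M c)" "q \<in> fst (tangent_chart M d)"
    and z: "z = snd (tangent_chart M c) q"
    using assms(3) unfolding tangent_chart_image[OF assms(1), symmetric] by blast
  obtain p u where pu: "q = (p, u)" by force
  have p: "p \<in> fst c" "p \<in> fst d" "u \<in> tangent_space M p"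
    using q by (auto simp: pu tangent_chart_def)
  then have "u d = jac c d p *v u c" using assms by (intro tangent_spaceD)
  then show ?thesis
    using assms p q(1) z
    by (simp add: transition_def[of "tangent_chart M c"] inv_chart_eq[OF tangent_chart_inj])
      (simp add: pu tangent_chart_def transition_eq[OF M] jac_mult_eq_frechet_derivative)
qed

text \<open>Component j of a transposed matrix applied to w is the inner product of the j-th column
  with w. The columns are derivatives of the reverse transition in the fixed directions
  \<open>axis j 1\<close>, the form that \<open>Ck\<close> can handle.\<close>

lemma cotangent_transition:
  assumes "c \<in> M" "d \<in> M" "z \<in> snd c ` (fst c \<inter> fst d) \<times> UNIV"
  shows "transition (cotangent_chart M c) (cotangent_chart M d) z =
    (transition c d (fst z),
     \<Sum>j\<in>UNIV. (frechet_derivative (transition d c) (at (transition c d (fst z))) (axis j 1) \<bullet> snd z) *\<^sub>R axis j 1)"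
proof -
  obtain q where q: "q \<in> fst (cotangent_chart M c)" "q \<in> fst (cotangent_chart M d)"
    and z: "z = snd (cotangent_chart M c) q"
    using assms(3) unfolding cotangent_chart_image[OF assms(1), symmetric] by blast
  obtain p u where pu: "q = (p, u)" by force
  have p: "p \<in> fst c" "p \<in> fst d" "u \<in> cotangent_space M p"
    using q by (auto simp: pu cotangent_chart_def)
  then have "u d = transpose (jac d c p) *v u c" using assms by (intro cotangent_spaceD)
  also have "\<dots> = (\<Sum>j\<in>UNIV. (axis j 1 \<bullet> (transpose (jac d c p) *v u c)) *\<^sub>R axis j 1)"
    by (simp add: vec_eq_iff inner_axis' del: transpose_matrix_vector) (simp add: axis_def if_distrib cong: if_cong)
  also have "\<dots> = (\<Sum>j\<in>UNIV. (frechet_derivative (transition d c) (at (snd d p)) (axis j 1) \<bullet> u c) *\<^sub>R axis j 1)"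
  proof -
    have "axis j 1 \<bullet> (transpose (jac d c p) *v u c) = (jac d c p *v axis j 1) \<bullet> u c" for j
      using dot_lmul_matrix[of "u c" "jac d c p" "axis j 1"] by (simp add: inner_commute)
    then show ?thesis
      using assms p by (simp only: jac_mult_eq_frechet_derivative)
  qed
  finally have "u d = \<dots>" .
  then show ?thesis
    using assms p q(1) z
    by (simp add: transition_def[of "cotangent_chart M c"] inv_chart_eq[OF cotangent_chart_inj])
      (simp add: pu cotangent_chart_def transition_eq[OF M])
qed

lemma smooth_atlas_tangent_bundle: "smooth_atlas (tangent_bundle M)"
proof -
  have "open (snd c ` (fst c \<inter> fst d) \<times> (UNIV :: (real^'n) set)) \<and>
      smooth_on (snd c ` (fst c \<inter> fst d) \<times> UNIV) (transition (tangent_chart M c) (tangent_chart M d))"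
    if c: "c \<in> M" and d: "d \<in> M" for c d
  proof -
    let ?S = "snd c ` (fst c \<inter> fst d)"
    let ?\<tau> = "transition c d"
    have S: "open ?S" "smooth_on ?S ?\<tau>" by (rule smooth_atlasD[OF M c], rule d)+
    then have T: "open (?S \<times> (UNIV :: (real^'n) set))" by (simp add: open_Times)
    \<comment> \<open>The fibre coordinate is itself the direction of differentiation and varies
      over the bundle chart, hence the expansion over \<open>Basis\<close>.\<close>
    have D: "frechet_derivative ?\<tau> (at x) v = (\<Sum>b\<in>Basis. (v \<bullet> b) *\<^sub>R frechet_derivative ?\<tau> (at x) b)"
      if "x \<in> ?S" for x v
      by (rule linear_Basis_expansion[OF has_derivative_linear[OF smooth_on_has_derivative[OF S(2) that]]])
    have "smooth_on (?S \<times> (UNIV :: (real^'n) set)) (\<lambda>z. (?\<tau> (fst z),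
        \<Sum>b\<in>Basis. (snd z \<bullet> b) *\<^sub>R frechet_derivative ?\<tau> (at (fst z)) b))"
      unfolding smooth_on_def
      by (intro allI Ck_Pair Ck_sum Ck_scaleR Ck_inner Ck_const Ck_bounded_linear bounded_linear_snd T
          smooth_on_Ck[OF smooth_on_fst_compose] smooth_on_frechet_derivative S)
    then have "smooth_on (?S \<times> UNIV) (transition (tangent_chart M c) (tangent_chart M d))"
      by (rule smooth_on_cong[OF T, rotated]) (auto simp: tangent_transition[OF c d] D[symmetric])
    with T show ?thesis by blast
  qed
  then show ?thesis
    by (simp add: smooth_atlas_def tangent_bundle_def tangent_chart_inj tangent_chart_image)
qed

lemma smooth_atlas_cotangent_bundle: "smooth_atlas (cotangent_bundle M)"
proof -
  have "open (snd c ` (fst c \<inter> fst d) \<times> (UNIV :: (real^'n) set)) \<and>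
      smooth_on (snd c ` (fst c \<inter> fst d) \<times> UNIV) (transition (cotangent_chart M c) (cotangent_chart M d))"
    if c: "c \<in> M" and d: "d \<in> M" for c d
  proof -
    let ?S = "snd c ` (fst c \<inter> fst d)"
    let ?\<tau> = "transition c d"
    have S: "open ?S" "smooth_on ?S ?\<tau>" by (rule smooth_atlasD[OF M c], rule d)+
    then have T: "open (?S \<times> (UNIV :: (real^'n) set))" by (simp add: open_Times)
    \<comment> \<open>The reverse transition is differentiated at the transformed point; since
      \<open>?\<tau>\<close> maps into the overlap as seen in \<open>d\<close>, this is a
      composition of smooth maps.\<close>
    have inv: "smooth_on ?S (\<lambda>x. frechet_derivative (transition d c) (at (?\<tau> x)) h)" for h
      by (rule smooth_on_compose[OF S(1) smooth_atlasD(4)[OF M d c] _ S(2)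
            smooth_on_frechet_derivative[OF smooth_atlasD(5)[OF M d c]]])
        (auto simp: transition_eq[OF M c])
    have "smooth_on (?S \<times> (UNIV :: (real^'n) set)) (\<lambda>z. (?\<tau> (fst z),
        \<Sum>j\<in>UNIV. (frechet_derivative (transition d c) (at (?\<tau> (fst z))) (axis j 1) \<bullet> snd z) *\<^sub>R axis j 1))"
      unfolding smooth_on_def
      by (intro allI Ck_Pair Ck_sum Ck_scaleR Ck_inner Ck_const Ck_bounded_linear bounded_linear_snd T
          smooth_on_Ck[OF smooth_on_fst_compose] S smooth_on_Ck[OF smooth_on_fst_compose[OF _ inv]])
    then have "smooth_on (?S \<times> UNIV) (transition (cotangent_chart M c) (cotangent_chart M d))"
      by (rule smooth_on_cong[OF T, rotated]) (auto simp: cotangent_transition[OF c d])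
    with T show ?thesis by blast
  qed
  then show ?thesis
    by (simp add: smooth_atlas_def cotangent_bundle_def cotangent_chart_inj cotangent_chart_image)
qed

section \<open>The map of a covector field in bundle charts\<close>

lemma fst_inv_tangent_chart:
  assumes "c \<in> M" "x \<in> snd c ` fst c"
  shows "inv_chart (tangent_chart M c) (x, v) \<in> fst (tangent_chart M c)"
    and "snd c (fst (inv_chart (tangent_chart M c) (x, v))) = x"
proof -
  have "(x, v) \<in> snd (tangent_chart M c) ` fst (tangent_chart M c)"
    using tangent_chart_image[OF assms(1), of c] assms(2) by simp
  then obtain q where q: "q \<in> fst (tangent_chart M c)" "(x, v) = snd (tangent_chart M c) q" by blast
  then have "inv_chart (tangent_chart M c) (x, v) = q"
    by (simp add: inv_chart_eq[OF tangent_chart_inj[OF assms(1)]])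
  with q show "inv_chart (tangent_chart M c) (x, v) \<in> fst (tangent_chart M c)"
    and "snd c (fst (inv_chart (tangent_chart M c) (x, v))) = x"
    by (auto simp: tangent_chart_def)
qed

lemma map_of_field_in_chart:
  assumes "c \<in> M" "x \<in> snd c ` fst c" and L: "extended_covector_field M L"
  shows "map_of_field L (inv_chart (tangent_chart M c) (x, v)) \<in> fst (cotangent_chart M c)"
    and "snd (cotangent_chart M c) (map_of_field L (inv_chart (tangent_chart M c) (x, v)))
      = (x, field_components M L c (x, v))"
proof -
  let ?q = "inv_chart (tangent_chart M c) (x, v)"
  note q = fst_inv_tangent_chart[OF assms(1,2), of v]
  have "?q \<in> carrier_of (tangent_bundle M)"
    using q(1) assms(1) by (auto simp: carrier_of_def tangent_bundle_def)
  then have "L ?q \<in> cotangent_space M (fst ?q)" using L by (simp add: extended_covector_field_def)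
  then show "map_of_field L ?q \<in> fst (cotangent_chart M c)"
    using q(1) by (auto simp: map_of_field_def cotangent_chart_def tangent_chart_def)
  show "snd (cotangent_chart M c) (map_of_field L ?q) = (x, field_components M L c (x, v))"
    using q(2) by (simp add: map_of_field_def cotangent_chart_def field_components_def)
qed

lemma map_of_field_rep:
  assumes "c \<in> M" "z \<in> (snd c ` fst c) \<times> UNIV" and L: "extended_covector_field M L"
  shows "(snd (cotangent_chart M c) \<circ> map_of_field L \<circ> inv_chart (tangent_chart M c)) z
      = (fst z, field_components M L c z)"
    and "map_of_field L (inv_chart (tangent_chart M c) z) \<in> fst (cotangent_chart M c)"
  using map_of_field_in_chart[OF assms(1) _ L, of "fst z" "snd z"] assms(2) by auto

lemma smooth_on_map_of_field_rep:
  assumes "c \<in> M" and L: "extended_covector_field M L" "smooth_field M L"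
  shows "smooth_on ((snd c ` fst c) \<times> UNIV)
    (snd (cotangent_chart M c) \<circ> map_of_field L \<circ> inv_chart (tangent_chart M c))"
proof -
  let ?S = "(snd c ` fst c) \<times> (UNIV :: (real^'n) set)"
  have S: "open ?S" using smooth_atlasD(2)[OF M assms(1)] by (simp add: open_Times)
  then have "smooth_on ?S (fst :: (real^'n) \<times> (real^'n) \<Rightarrow> real^'n)"
    unfolding smooth_on_def by (blast intro: Ck_bounded_linear bounded_linear_fst)
  then have "smooth_on ?S (\<lambda>z. (fst z, field_components M L c z))"
    using L(2) assms(1) by (intro smooth_on_Pair S) (auto simp: smooth_field_def)
  then show ?thesis
    by (rule smooth_on_cong[OF S, rotated]) (simp add: map_of_field_rep(1)[OF assms(1) _ L(1)] del: o_apply)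
qed

lemma tangent_chart_domain: "c \<in> M \<Longrightarrow> snd (tangent_chart M c) ` fst (tangent_chart M c) = (snd c ` fst c) \<times> UNIV"
  using tangent_chart_image[of c c] by simp

text \<open>The base point is preserved, so points over the domain of \<open>c\<close> stay over it.
  The whole tangent chart over \<open>c\<close>, paired with the cotangent chart over the same
  \<open>c\<close>, therefore serves as the neighbourhood in
  \<open>smooth_map_localI\<close>.\<close>

lemma generalized_Legendre_map_of_field:
  assumes L: "extended_covector_field M L" "smooth_field M L"
  shows "generalized_Legendre_map M (map_of_field L)"
  unfolding generalized_Legendre_map_def
proof
  show "smooth_map (tangent_bundle M) (cotangent_bundle M) (map_of_field L)"
  proof (rule smooth_map_localI[OF smooth_atlas_tangent_bundle smooth_atlas_cotangent_bundle])
    fix q assume "q \<in> carrier_of (tangent_bundle M)"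
    then obtain c where c: "c \<in> M" and q: "q \<in> fst (tangent_chart M c)"
      by (auto simp: carrier_of_def tangent_bundle_def)
    let ?Z = "(snd c ` fst c) \<times> (UNIV :: (real^'n) set)"
    have "open ?Z" using smooth_atlasD(2)[OF M c] by (simp add: open_Times)
    moreover have "snd (tangent_chart M c) q \<in> ?Z" using q tangent_chart_domain[OF c] by blast
    ultimately show "\<exists>c\<in>tangent_bundle M. \<exists>d\<in>cotangent_bundle M. \<exists>Z. open Z \<and> Z \<subseteq> snd c ` fst c \<and>
      q \<in> fst c \<and> snd c q \<in> Z \<and> (\<forall>z\<in>Z. map_of_field L (inv_chart c z) \<in> fst d) \<and>
      smooth_on Z (snd d \<circ> map_of_field L \<circ> inv_chart c)"
      using c q smooth_on_map_of_field_rep[OF c L] map_of_field_rep(2)[OF c _ L(1)]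
      by (intro bexI[of _ "tangent_chart M c"] bexI[of _ "cotangent_chart M c"] exI[of _ ?Z])
        (simp_all add: tangent_chart_domain tangent_bundle_def cotangent_bundle_def)
  qed
qed (simp add: map_of_field_def)

lemma local_diffeomorphism_map_of_field:
  assumes L: "extended_covector_field M L" "smooth_field M L"
    and nondegenerate: "\<And>c x v. c \<in> M \<Longrightarrow> x \<in> snd c ` fst c \<Longrightarrow>
      det (g_matrix (field_components M L c) (x, v)) \<noteq> 0"
  shows "local_diffeomorphism (tangent_bundle M) (cotangent_bundle M) (map_of_field L)"
proof (rule local_diffeomorphismI[OF smooth_atlas_tangent_bundle smooth_atlas_cotangent_bundle])
  fix q assume "q \<in> carrier_of (tangent_bundle M)"
  then obtain c where c: "c \<in> M" and q: "q \<in> fst (tangent_chart M c)"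
    by (auto simp: carrier_of_def tangent_bundle_def)
  let ?S = "(snd c ` fst c) \<times> (UNIV :: (real^'n) set)"
  let ?F = "field_components M L c"
  have S: "open ?S" using smooth_atlasD(2)[OF M c] by (simp add: open_Times)
  have F: "smooth_on ?S ?F" using L(2) c by (simp add: smooth_field_def)
  have qS: "snd (tangent_chart M c) q \<in> ?S" using q tangent_chart_domain[OF c] by blast
  \<comment> \<open>Non-degeneracy of g is carried over to the fibre block of the Frechet derivative
    on the whole bundle chart, as the bootstrap in the inverse function theorem requires.\<close>
  have "det (matrix (\<lambda>k. frechet_derivative ?F (at z) (0, k))) \<noteq> 0" if "z \<in> ?S" for z
    using nondegenerate[OF c, of "fst z" "snd z"] g_matrix_eq_matrix[OF F that] that by auto
  from fibred_inverse_function_theorem[OF S qS F this]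
  obtain U V g where U: "open U" "U \<subseteq> ?S" "snd (tangent_chart M c) q \<in> U" and V: "open V"
    and hom: "homeomorphism U V (\<lambda>z. (fst z, ?F z)) g" and g: "smooth_on V g"
    by blast
  let ?\<phi> = "snd (cotangent_chart M c) \<circ> map_of_field L \<circ> inv_chart (tangent_chart M c)"
  have "homeomorphism U V ?\<phi> g"
    by (rule homeomorphism_cong[OF hom]) (use U(2) map_of_field_rep(1)[OF c _ L(1)] in auto)
  moreover have "smooth_on U ?\<phi>"
    by (rule smooth_on_subset[OF smooth_on_map_of_field_rep[OF c L] U(2)])
  moreover have "\<forall>z\<in>U. map_of_field L (inv_chart (tangent_chart M c) z) \<in> fst (cotangent_chart M c)"
    using U(2) map_of_field_rep(2)[OF c _ L(1)] by blast
  ultimately show "\<exists>c\<in>tangent_bundle M. \<exists>d\<in>cotangent_bundle M. \<exists>U V g. open U \<and> U \<subseteq> snd c ` fst c \<and>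
      q \<in> fst c \<and> snd c q \<in> U \<and> open V \<and> (\<forall>z\<in>U. map_of_field L (inv_chart c z) \<in> fst d) \<and>
      homeomorphism U V (snd d \<circ> map_of_field L \<circ> inv_chart c) g \<and>
      smooth_on U (snd d \<circ> map_of_field L \<circ> inv_chart c) \<and> smooth_on V g"
    using c q U V g
    by (intro bexI[of _ "tangent_chart M c"] bexI[of _ "cotangent_chart M c"] exI[of _ U] exI[of _ V] exI[of _ g])
      (simp_all add: tangent_chart_domain tangent_bundle_def cotangent_bundle_def)
qed

end

theorem theorem5p1:
  fixes M :: "('m, real^'n) atlas"
    and L A :: "('m, 'n) bundle_point \<Rightarrow> ('m, 'n) components"
  assumes dim: "CARD('n) \<ge> 3"
    and M: "smooth_manifold M"
    and L: "extended_covector_field M L" "smooth_field M L"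
    and A: "extended_covector_field M A"
    and equations: "\<And>c x v r s. c \<in> M \<Longrightarrow> x \<in> snd c ` fst c \<Longrightarrow>
      dv (field_components M L c) s r (x, v) - dv (field_components M L c) r s (x, v)
      = field_components M L c (x, v) $ s * field_components M A c (x, v) $ r
        - field_components M L c (x, v) $ r * field_components M A c (x, v) $ s"
    and nondegenerate: "\<And>c x v. c \<in> M \<Longrightarrow> x \<in> snd c ` fst c \<Longrightarrow>
      det (g_matrix (field_components M L c) (x, v)) \<noteq> 0"
    and norm_nonzero: "\<And>c x v. c \<in> M \<Longrightarrow> x \<in> snd c ` fst c \<Longrightarrow>
      square_norm (field_components M L c) (x, v) \<noteq> 0"
    and condition: "\<And>c x v. c \<in> M \<Longrightarrow> x \<in> snd c ` fst c \<Longrightarrow>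
      det (u_matrix (field_components M L c) (field_components M A c) (x, v)) = 0 \<or>
      det (u_matrix (field_components M L c) (field_components M A c) (x, v)) \<noteq> 0 \<and>
      u_norm (field_components M L c) (field_components M A c) (x, v) \<noteq> 0"
  shows "generalized_Legendre_map M (map_of_field L) \<and>
    local_diffeomorphism (tangent_bundle M) (cotangent_bundle M) (map_of_field L) \<and>
    (\<forall>c\<in>M. \<forall>x\<in>snd c ` fst c. \<forall>v.
      snd (cotangent_chart M c)
          (map_of_field L (inv_chart (tangent_chart M c) (x, v)))
        = (x, field_components M L c (x, v)))"
proof (intro conjI ballI allI)
  have atlas: "smooth_atlas M" using M by (simp add: smooth_manifold_def)
  show "generalized_Legendre_map M (map_of_field L)"
    by (rule generalized_Legendre_map_of_field[OF atlas L])
  show "local_diffeomorphism (tangent_bundle M) (cotangent_bundle M) (map_of_field L)"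
    by (rule local_diffeomorphism_map_of_field[OF atlas L nondegenerate])
  show "snd (cotangent_chart M c) (map_of_field L (inv_chart (tangent_chart M c) (x, v)))
      = (x, field_components M L c (x, v))" if "c \<in> M" "x \<in> snd c ` fst c" for c x v
    by (rule map_of_field_in_chart(2)[OF atlas that L(1)])
qed

end
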